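(* The space $\mathcal{F}_{N,d}^{\mathbb{C}}$ is path-connected for all integers $d$ and $N$ satisfying $d\geq 1$ and $N\geq d$.
   Context: A finite unit norm tight frame (FUNTF) of $N$ vectors in $\mathbb{C}^d$ is an indexed collection $F=\{f_n\}_{n=1}^N\subset\mathbb{C}^d$ with $\|f_n\|=1$ for all $n$ and $\sum_{n=1}^N f_nf_n^*=\frac{N}{d}I_d$. It is identified with the $d\times N$ complex matrix $F=(f_1\ \cdots\ f_N)$, so that the tightness condition is $FF^*=\frac{N}{d}I_d$. $\mathcal{F}_{N,d}^{\mathbb{C}}$ denotes the set of all such FUNTFs, with the topology inherited from the Euclidean space of $d\times N$ complex matrices. *)

theory Defs
  imports "HOL-Analysis.Analysis"
begin

text \<open>
  The type \<open>complex^'n^'d\<close> is the space of \<open>d \<times> N\<close> complex matrices, with \<open>d = CARD('d)\<close> rows and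
  \<open>N = CARD('n)\<close> columns; its norm is the Frobenius norm, so its topology is the Euclidean one.
\<close>

definition conj_transpose :: "complex^'n^'m \<Rightarrow> complex^'m^'n" where
  "conj_transpose A = (\<chi> i j. cnj (A $ j $ i))"

text \<open>
  A frame \<open>(f\<^sub>n)\<close> is identified with the matrix \<open>F\<close> whose columns are the \<open>f\<^sub>n\<close>, so the frame operator
  (the sum of the \<open>f\<^sub>n f\<^sub>n\<^sup>*\<close>) is \<open>F F\<^sup>*\<close>. The norm on \<open>complex^'d\<close> is the Hermitian one, and
  \<open>mat c\<close> is \<open>c\<close> times the identity.
\<close>

definition FUNTF :: "(complex^'n^'d) set" where
  "FUNTF = {F. (\<forall>n. norm (column n F) = 1) \<and>
               F ** conj_transpose F = mat (of_nat CARD('n) / of_nat CARD('d))}"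

end

theory Submission
  imports Defs "HOL-Computational_Algebra.Polynomial"
begin

text \<open>
  Write \<open>N = CARD('n)\<close> and \<open>d = CARD('d)\<close>. The proof retracts an open set of matrices
  whose connectedness is easy to see onto a part of the space of FUNTFs that every FUNTF can reach.

  \<^bold>\<open>Scaling to a tight frame.\<close> Rescaling the columns of a matrix \<open>F\<close> by \<open>exp (y\<^sub>n / 2)\<close> and then
  orthonormalizing the rows gives a matrix \<open>Q\<close> with \<open>Q Q\<^sup>* = 1\<close>, and \<open>F\<close> has been turned into a FUNTF
  as soon as the columns of \<open>Q\<close> have equal norms. By a weighted Cauchy-Binet identity
  (\<open>weighted_column_norms\<close>) these norms are determined, up to a common factor, by the squared maximal
  minors of \<open>Q\<close>, which are proportional to those of \<open>F\<close> times exponentials of partial sums of \<open>y\<close>. Equality of the norms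
  says exactly that \<open>y\<close> is a critical point, on the hyperplane of vectors with coordinate sum zero, of
  the sum of exponentials \<open>potential F\<close>. This function is convex, so critical points are minimizers.
  For a \<^emph>\<open>stable\<close> matrix, one with enough nonzero minors, it is coercive and strictly convex on the
  hyperplane. Its minimizer is then unique and depends continuously on \<open>F\<close>. If \<open>F\<close> is already a FUNTF,
  the minimizer is \<open>0\<close> and \<open>F\<close> is not moved. Hence the stable FUNTFs lie in a continuous
  image, inside the space of FUNTFs, of the set of stable matrices (\<open>FUNTF_path_by_retraction\<close>).

  \<^bold>\<open>The stable matrices are path-connected.\<close> Stability only asks that certain minors do not vanish.
  On the complex line through two matrices each minor is a polynomial, so all but finitely many points
  of the line inherit the nonzero minors of an endpoint, and a complex line minus finitely many
  points is path-connected (\<open>path_connected_minor_support\<close>).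

  \<^bold>\<open>Reaching the stable FUNTFs.\<close> A FUNTF is stable when its correlation graph, joining \<open>m\<close> and \<open>n\<close> if
  the columns \<open>f\<^sub>m\<close> and \<open>f\<^sub>n\<close> are not orthogonal, is connected (\<open>connected_FUNTF_stable\<close>). If
  \<open>N > d\<close> and the graph is disconnected, two columns from different components are orthogonal.
  Rotating them into one another is a path of FUNTFs that merges the two components
  (\<open>merge_components\<close>). Finitely many such rotations make the graph connected.

  For \<open>N = d\<close> the FUNTFs are the unitary matrices, and the same retraction applies to the
  matrices with a nonzero determinant, now without any scaling of the columns.
\<close>

section \<open>The Hermitian form and matrices with orthonormal rows\<close>

definition herm :: "complex^'n \<Rightarrow> complex^'n \<Rightarrow> complex" where
  "herm u v = (\<Sum>i\<in>UNIV. u $ i * cnj (v $ i))"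

lemma herm_self: "herm u u = of_real ((norm u)\<^sup>2)"
proof -
  have "herm u u = (\<Sum>i\<in>UNIV. of_real ((norm (u $ i))\<^sup>2))"
    unfolding herm_def by (simp add: complex_norm_square del: of_real_power)
  also have "\<dots> = of_real ((norm u)\<^sup>2)"
    by (simp add: norm_vec_def L2_set_def sum_nonneg)
  finally show ?thesis .
qed

lemma herm_cnj: "cnj (herm u v) = herm v u"
  unfolding herm_def by (simp add: mult.commute)

lemma herm_add_left: "herm (u + v) w = herm u w + herm v w"
  by (simp add: herm_def sum.distrib algebra_simps)

lemma herm_add_right: "herm w (u + v) = herm w u + herm w v"
  by (simp add: herm_def sum.distrib algebra_simps)

lemma herm_diff_left: "herm (u - v) w = herm u w - herm v w"
  by (simp add: herm_def sum_subtractf algebra_simps)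

lemma herm_diff_right: "herm w (u - v) = herm w u - herm w v"
  by (simp add: herm_def sum_subtractf algebra_simps)

lemma herm_sum_left: "herm (\<Sum>j\<in>A. f j) w = (\<Sum>j\<in>A. herm (f j) w)"
  by (simp add: herm_def sum_distrib_right) (rule sum.swap)

lemma herm_smult_left: "herm (c *s u) w = c * herm u w"
  by (simp add: herm_def sum_distrib_left mult.assoc)

lemma herm_smult_right: "herm u (c *s w) = cnj c * herm u w"
  by (simp add: herm_def sum_distrib_left mult_ac)

lemma norm_eq_1_iff_herm: "norm u = 1 \<longleftrightarrow> herm u u = 1"
  unfolding herm_self by (simp add: abs_square_eq_1 del: of_real_power)

lemma herm_cauchy_schwarz: "cmod (herm u v) \<le> norm u * norm v"
proof -
  have "cmod (herm u v) \<le> (\<Sum>i\<in>UNIV. \<bar>cmod (u $ i)\<bar> * \<bar>cmod (v $ i)\<bar>)"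
    unfolding herm_def by (rule order_trans[OF norm_sum]) (simp add: norm_mult)
  also have "\<dots> \<le> norm u * norm v"
    unfolding norm_vec_def by (rule L2_set_mult_ineq)
  finally show ?thesis .
qed

lemma frame_operator_entry: "(F ** conj_transpose F) $ i $ j = herm (F $ i) (F $ j)"
  by (simp add: matrix_matrix_mult_def conj_transpose_def herm_def)

lemma orthonormal_rows_iff:
  "Q ** conj_transpose Q = mat 1 \<longleftrightarrow> (\<forall>i j. herm (Q $ i) (Q $ j) = (if i = j then 1 else 0))"
  by (simp add: vec_eq_iff frame_operator_entry mat_def)

lemma norm_column: "(norm (column n F))\<^sup>2 = (\<Sum>i\<in>UNIV. (cmod (F $ i $ n))\<^sup>2)"
  by (simp add: norm_vec_def L2_set_def sum_nonneg column_def)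

lemma sum_column_norms:
  fixes Q :: "complex^'n^'d"
  assumes "Q ** conj_transpose Q = mat 1"
  shows "(\<Sum>n\<in>UNIV. (norm (column n Q))\<^sup>2) = real CARD('d)"
proof -
  have "(norm (Q $ i))\<^sup>2 = 1" for i
    using assms[unfolded orthonormal_rows_iff, rule_format, of i i] unfolding herm_self
    by (simp del: of_real_power)
  moreover have "(\<Sum>n\<in>UNIV. (norm (column n Q))\<^sup>2) = (\<Sum>i\<in>UNIV. (norm (Q $ i))\<^sup>2)"
    unfolding norm_column by (subst sum.swap) (simp add: norm_vec_def L2_set_def sum_nonneg)
  ultimately show ?thesis by simp
qed

lemma orthonormal_rows_isometry:
  fixes Q :: "complex^'n^'d"
  assumes "Q ** conj_transpose Q = mat 1"
  shows "norm (z v* Q) = norm z"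
proof -
  have o: "herm (Q $ i) (Q $ j) = (if i = j then 1 else 0)" for i j
    using assms unfolding orthonormal_rows_iff by blast
  have zQ: "z v* Q = (\<Sum>i\<in>UNIV. z $ i *s Q $ i)"
    by (simp add: vec_eq_iff vector_matrix_mult_def mult.commute)
  have "herm (Q $ i) (z v* Q) = cnj (z $ i)" for i
  proof -
    have "herm (z v* Q) (Q $ i) = z $ i"
      unfolding zQ herm_sum_left herm_smult_left o by (simp add: if_distrib cong: if_cong)
    then show ?thesis using herm_cnj[of "z v* Q" "Q $ i"] by simp
  qed
  then have "herm (z v* Q) (z v* Q) = (\<Sum>i\<in>UNIV. z $ i * cnj (z $ i))"
    by (subst (1) zQ) (simp add: herm_sum_left herm_smult_left)
  also have "\<dots> = herm z z" by (simp add: herm_def)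
  finally show ?thesis unfolding herm_self by (simp del: of_real_power)
qed

text \<open>
  The correlations of the \<open>n\<close>-th column with all columns are the entries of a combination of the
  rows of \<open>Q\<close>, with the conjugate entries of that column as coefficients.
\<close>

lemma sum_squared_correlations:
  fixes Q :: "complex^'n^'d"
  assumes Q: "Q ** conj_transpose Q = mat 1"
  shows "(\<Sum>m\<in>UNIV. (cmod (herm (column m Q) (column n Q)))\<^sup>2) = (norm (column n Q))\<^sup>2"
proof -
  define z where "z = (\<chi> i. cnj (Q $ i $ n))"
  have "herm (column m Q) (column n Q) = (z v* Q) $ m" for m
    by (simp add: herm_def column_def z_def vector_matrix_mult_def mult.commute)
  then have "(\<Sum>m\<in>UNIV. (cmod (herm (column m Q) (column n Q)))\<^sup>2) = (norm (z v* Q))\<^sup>2"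
    by (simp add: norm_vec_def L2_set_def sum_nonneg)
  also have "\<dots> = (norm (column n Q))\<^sup>2"
    unfolding orthonormal_rows_isometry[OF Q]
    by (simp add: z_def norm_vec_def L2_set_def column_def)
  finally show ?thesis .
qed

section \<open>Maximal minors and column norms\<close>

text \<open>
  The columns are selected by an arbitrary function rather than by a set of size \<open>d\<close>. This needs no order
  on the index types, and a repeated column just contributes a zero minor. Every genuine minor
  occurs \<open>d!\<close> times, up to sign.
\<close>

definition minor :: "complex^'n^'d \<Rightarrow> ('d \<Rightarrow> 'n) \<Rightarrow> complex" where
  "minor F \<phi> = det (\<chi> i j. F $ j $ \<phi> i)"

definition weight :: "complex^'n^'d \<Rightarrow> ('d \<Rightarrow> 'n) \<Rightarrow> real" where
  "weight F \<phi> = (cmod (minor F \<phi>))\<^sup>2"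

lemma weight_nonneg [simp]: "0 \<le> weight F \<phi>"
  by (simp add: weight_def)

lemma weight_eq_0_iff [simp]: "weight F \<phi> = 0 \<longleftrightarrow> minor F \<phi> = 0"
  by (simp add: weight_def)

text \<open>
  The exponent by which \<open>weight F \<phi>\<close> grows when, for every \<open>n\<close>, the \<open>n\<close>-th column is scaled
  by \<open>exp (h\<^sub>n / 2)\<close>.
\<close>

definition sum_along :: "real^'n \<Rightarrow> ('d::finite \<Rightarrow> 'n) \<Rightarrow> real" where
  "sum_along h \<phi> = (\<Sum>i\<in>UNIV. h $ \<phi> i)"

lemma sum_along_0 [simp]: "sum_along 0 \<phi> = 0"
  by (simp add: sum_along_def)

lemma sum_along_add: "sum_along (a + b) \<phi> = sum_along a \<phi> + sum_along b \<phi>"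
  by (simp add: sum_along_def sum.distrib)

lemma sum_along_scaleR: "sum_along (c *\<^sub>R a) \<phi> = c * sum_along a \<phi>"
  by (simp add: sum_along_def sum_distrib_left)

lemma minor_mult: "minor (L ** F) \<phi> = det L * minor F \<phi>"
proof -
  have "(\<chi> i j. (L ** F) $ j $ \<phi> i) = (\<chi> i j. F $ j $ \<phi> i) ** transpose L"
    by (simp add: matrix_matrix_mult_def transpose_def vec_eq_iff mult.commute)
  then show ?thesis unfolding minor_def by (simp add: det_mul)
qed

definition colscale :: "('n \<Rightarrow> real) \<Rightarrow> complex^'n^'d \<Rightarrow> complex^'n^'d" where
  "colscale c F = (\<chi> i n. of_real (c n) * F $ i $ n)"

lemma minor_colscale: "minor (colscale c F) \<phi> = of_real (\<Prod>i\<in>UNIV. c (\<phi> i)) * minor F \<phi>"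
  using det_rows_mul[of "\<lambda>i. complex_of_real (c (\<phi> i))" "\<lambda>i. \<chi> j. F $ j $ \<phi> i"]
  by (simp add: minor_def colscale_def vector_scalar_mult_def)

lemma minor_scaleR:
  fixes F :: "complex^'n^'d"
  shows "minor (s *\<^sub>R F) \<phi> = of_real (s ^ CARD('d)) * minor F \<phi>"
proof -
  have "s *\<^sub>R F = colscale (\<lambda>_. s) F"
    unfolding vec_eq_iff vector_scaleR_component by (simp add: colscale_def scaleR_conv_of_real)
  then show ?thesis by (simp add: minor_colscale)
qed

text \<open>
  Row-wise multilinearity of the determinant of a product of a \<open>d \<times> N\<close> and an \<open>N \<times> d\<close> matrix. It is the
  Cauchy-Binet formula before the terms that differ by a permutation of the rows are collected.
\<close>

lemma det_product_expand:
  fixes a :: "'d::finite \<Rightarrow> 'n::finite \<Rightarrow> complex"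
  shows "det (\<chi> i j. \<Sum>n\<in>UNIV. a i n * c n j) =
    (\<Sum>\<phi>\<in>UNIV. (\<Prod>i\<in>UNIV. a i (\<phi> i)) * det (\<chi> i j. c (\<phi> i) j))"
proof -
  have "det (\<chi> i j. \<Sum>n\<in>UNIV. a i n * c n j) =
     (\<Sum>p | p permutes UNIV. of_int (sign p) * (\<Sum>\<phi>\<in>UNIV. \<Prod>i\<in>UNIV. a i (\<phi> i) * c (\<phi> i) (p i)))"
    unfolding det_def by (simp add: prod_sum_PiE)
  also have "\<dots> = (\<Sum>\<phi>\<in>UNIV. \<Sum>p | p permutes UNIV. of_int (sign p) * (\<Prod>i\<in>UNIV. a i (\<phi> i) * c (\<phi> i) (p i)))"
    by (simp add: sum_distrib_left) (rule sum.swap)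
  also have "\<dots> = (\<Sum>\<phi>\<in>UNIV. (\<Prod>i\<in>UNIV. a i (\<phi> i)) * det (\<chi> i j. c (\<phi> i) j))"
    unfolding det_def by (simp add: prod.distrib sum_distrib_left mult_ac)
  finally show ?thesis .
qed

lemma minor_permute:
  assumes "p permutes UNIV"
  shows "minor F (\<phi> \<circ> p) = of_int (sign p) * minor F \<phi>"
  using det_permute_rows[OF assms, of "\<chi> i j. F $ j $ \<phi> i"] unfolding minor_def by simp

lemma minor_expand: "minor F \<phi> = (\<Sum>p | p permutes UNIV. of_int (sign p) * (\<Prod>i\<in>UNIV. F $ i $ \<phi> (p i)))"
proof -
  have "minor F \<phi> = det (transpose (\<chi> i j. F $ j $ \<phi> i))"
    unfolding minor_def by (simp only: det_transpose)
  then show ?thesis unfolding det_def transpose_def by simp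
qed

lemma det_cnj: "cnj (det A) = det (\<chi> i j. cnj (A $ i $ j))"
  unfolding det_def by simp

text \<open>
  Expanding one of the two factors of \<open>\<bar>minor F \<phi>\<bar>\<^sup>2\<close> by Leibniz and absorbing the permutation into
  \<open>\<phi>\<close> turns the weights into the terms of \<open>det_product_expand\<close>. The permutation changes neither
  the symmetric function \<open>g\<close> nor, because its sign appears twice, the rest of the term.
\<close>

lemma weight_sum_symmetric:
  fixes F :: "complex^'n^'d" and g :: "('d \<Rightarrow> 'n) \<Rightarrow> complex"
  assumes g: "\<And>p \<phi>. p permutes UNIV \<Longrightarrow> g (\<phi> \<circ> p) = g \<phi>"
  shows "(\<Sum>\<phi>\<in>UNIV. g \<phi> * of_real (weight F \<phi>)) =
    fact CARD('d) * (\<Sum>\<phi>\<in>UNIV. g \<phi> * (\<Prod>i\<in>UNIV. F $ i $ \<phi> i) * cnj (minor F \<phi>))"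
proof -
  let ?t = "\<lambda>\<phi>. g \<phi> * (\<Prod>i\<in>UNIV. F $ i $ \<phi> i) * cnj (minor F \<phi>)"
  let ?P = "{p::'d\<Rightarrow>'d. p permutes UNIV}"
  have expand: "g \<phi> * (of_int (sign p) * (\<Prod>i\<in>UNIV. F $ i $ \<phi> (p i))) * cnj (minor F \<phi>) = ?t (\<phi> \<circ> p)"
    if p: "p \<in> ?P" for p \<phi>
  proof -
    have "of_int (sign p) * of_int (sign p) = (1::complex)"
      by (metis of_int_1 of_int_mult sign_idempotent)
    then show ?thesis using p by (simp add: g minor_permute)
  qed
  have "(\<Sum>\<phi>\<in>UNIV. g \<phi> * of_real (weight F \<phi>)) = (\<Sum>\<phi>\<in>UNIV. g \<phi> * minor F \<phi> * cnj (minor F \<phi>))"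
    unfolding weight_def by (simp add: complex_norm_square mult.assoc del: of_real_power)
  also have "\<dots> = (\<Sum>\<phi>\<in>UNIV. \<Sum>p\<in>?P. g \<phi> * (of_int (sign p) * (\<Prod>i\<in>UNIV. F $ i $ \<phi> (p i))) * cnj (minor F \<phi>))"
    by (subst minor_expand) (simp add: sum_distrib_left sum_distrib_right mult.assoc)
  also have "\<dots> = (\<Sum>\<phi>\<in>UNIV. \<Sum>p\<in>?P. ?t (\<phi> \<circ> p))"
    by (intro sum.cong refl expand)
  also have "\<dots> = (\<Sum>p\<in>?P. \<Sum>\<phi>\<in>UNIV. ?t (\<phi> \<circ> p))"
    by (rule sum.swap)
  also have "\<dots> = (\<Sum>p\<in>?P. \<Sum>\<phi>\<in>UNIV. ?t \<phi>)"
  proof (rule sum.cong)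
    fix p assume "p \<in> ?P"
    then have b: "bij p" by (simp add: permutes_bij)
    have "bij_betw (\<lambda>\<phi>::'d\<Rightarrow>'n. \<phi> \<circ> p) UNIV UNIV"
      using b by (intro bij_betw_byWitness[where f' = "\<lambda>\<phi>. \<phi> \<circ> inv p"])
        (auto simp: fun_eq_iff bij_is_inj bij_is_surj surj_f_inv_f)
    from sum.reindex_bij_betw[OF this, of ?t]
    show "(\<Sum>\<phi>\<in>UNIV. ?t (\<phi> \<circ> p)) = (\<Sum>\<phi>\<in>UNIV. ?t \<phi>)" .
  qed simp
  also have "\<dots> = fact CARD('d) * (\<Sum>\<phi>\<in>UNIV. ?t \<phi>)"
    by (simp add: card_permutations)
  finally show ?thesis .
qed

text \<open>
  This links the minors to the column norms. Up to \<open>d!\<close>, the sum is the derivative at \<open>t = 0\<close>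
  of the determinant of \<open>Q (1 + t diag h) Q\<^sup>*\<close>, which is the trace of \<open>Q diag h Q\<^sup>*\<close>. The proof takes the
  derivative row by row: scaling the \<open>k\<close>-th row only leaves the determinant of an identity matrix with
  one row replaced, which Cramer's rule evaluates.
\<close>

lemma weighted_column_norms:
  fixes Q :: "complex^'n^'d"
  assumes Q: "Q ** conj_transpose Q = mat 1"
  shows "(\<Sum>\<phi>\<in>UNIV. sum_along h \<phi> * weight Q \<phi>) = fact CARD('d) * (\<Sum>n\<in>UNIV. h $ n * (norm (column n Q))\<^sup>2)"
proof -
  have onb: "herm (Q $ i) (Q $ j) = (if i = j then 1 else 0)" for i j
    unfolding frame_operator_entry[symmetric] Q by (simp add: mat_def)
  have symm: "(\<Sum>i\<in>UNIV. complex_of_real (h $ \<phi> (p i))) = (\<Sum>i\<in>UNIV. of_real (h $ \<phi> i))"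
    if "p permutes UNIV" for p and \<phi> :: "'d \<Rightarrow> 'n"
    using sum.permute[OF that, of "\<lambda>i. complex_of_real (h $ \<phi> i)"] by (simp add: o_def)
  have row: "(\<Sum>\<phi>\<in>UNIV. of_real (h $ \<phi> k) * (\<Prod>i\<in>UNIV. Q $ i $ \<phi> i) * cnj (minor Q \<phi>))
      = (\<Sum>n\<in>UNIV. of_real (h $ n) * (Q $ k $ n * cnj (Q $ k $ n)))" for k :: 'd
  proof -
    \<comment> \<open>\<open>v\<close> is the row \<open>k\<close> of \<open>Q diag h Q\<^sup>*\<close>; it replaces the row \<open>k\<close> of \<open>Q Q\<^sup>* = 1\<close>.\<close>
    define a where "a i n = (if i = k then of_real (h $ n) * Q $ i $ n else Q $ i $ n)" for i n
    define v where "v = (\<chi> j. \<Sum>n\<in>UNIV. of_real (h $ n) * Q $ k $ n * cnj (Q $ j $ n))"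
    have pr: "(\<Prod>i\<in>UNIV. a i (\<phi> i)) = of_real (h $ \<phi> k) * (\<Prod>i\<in>UNIV. Q $ i $ \<phi> i)" for \<phi>
    proof -
      have "(\<Prod>i\<in>UNIV. a i (\<phi> i)) = (\<Prod>i\<in>UNIV. (if i = k then of_real (h $ \<phi> i) else 1) * Q $ i $ \<phi> i)"
        by (rule prod.cong) (auto simp: a_def)
      then show ?thesis by (simp add: prod.distrib)
    qed
    have "(\<Sum>\<phi>\<in>UNIV. of_real (h $ \<phi> k) * (\<Prod>i\<in>UNIV. Q $ i $ \<phi> i) * cnj (minor Q \<phi>))
       = (\<Sum>\<phi>\<in>UNIV. (\<Prod>i\<in>UNIV. a i (\<phi> i)) * det (\<chi> i j. cnj (Q $ j $ \<phi> i)))"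
      unfolding pr minor_def det_cnj by simp
    also have "\<dots> = det (\<chi> i j. \<Sum>n\<in>UNIV. a i n * cnj (Q $ j $ n))"
      by (rule det_product_expand[symmetric])
    also have "(\<chi> i j. \<Sum>n\<in>UNIV. a i n * cnj (Q $ j $ n)) =
        (\<chi> i. if i = k then (\<Sum>i\<in>UNIV. v $ i *s row i (mat 1)) else row i (mat 1))"
    proof -
      have "(\<Sum>i\<in>UNIV. v $ i *s row i (mat 1)) = v"
        by (simp add: vec_eq_iff row_def mat_def if_distrib cong: if_cong)
      moreover have "(\<Sum>n\<in>UNIV. Q $ i $ n * cnj (Q $ j $ n)) = (if i = j then 1 else 0)" for i j
        using onb[of i j] by (simp add: herm_def)
      ultimately show ?thesis
        by (auto simp: vec_eq_iff a_def v_def row_def mat_def)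
    qed
    also have "det \<dots> = v $ k" by (simp only: cramer_lemma_transpose det_I mult_1_right)
    finally show ?thesis by (simp add: v_def mult.assoc)
  qed
  have "complex_of_real (\<Sum>\<phi>\<in>UNIV. sum_along h \<phi> * weight Q \<phi>) =
      (\<Sum>\<phi>\<in>UNIV. (\<Sum>i\<in>UNIV. of_real (h $ \<phi> i)) * of_real (weight Q \<phi>))"
    by (simp add: sum_along_def)
  also have "\<dots> = fact CARD('d) * (\<Sum>\<phi>\<in>UNIV. (\<Sum>i\<in>UNIV. of_real (h $ \<phi> i)) * (\<Prod>i\<in>UNIV. Q $ i $ \<phi> i) * cnj (minor Q \<phi>))"
    by (rule weight_sum_symmetric) (simp add: symm)
  also have "(\<Sum>\<phi>\<in>UNIV. (\<Sum>i\<in>UNIV. complex_of_real (h $ \<phi> i)) * (\<Prod>i\<in>UNIV. Q $ i $ \<phi> i) * cnj (minor Q \<phi>))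
      = (\<Sum>k\<in>UNIV. \<Sum>\<phi>\<in>UNIV. of_real (h $ \<phi> k) * (\<Prod>i\<in>UNIV. Q $ i $ \<phi> i) * cnj (minor Q \<phi>))"
    by (subst sum.swap) (simp add: sum_distrib_right mult.assoc)
  also have "\<dots> = (\<Sum>n\<in>UNIV. of_real (h $ n) * (\<Sum>k\<in>UNIV. Q $ k $ n * cnj (Q $ k $ n)))"
    unfolding row by (subst sum.swap) (simp add: sum_distrib_left)
  also have "\<dots> = of_real (\<Sum>n\<in>UNIV. h $ n * (norm (column n Q))\<^sup>2)"
    by (simp add: norm_column complex_norm_square del: of_real_power)
  finally have "complex_of_real (\<Sum>\<phi>\<in>UNIV. sum_along h \<phi> * weight Q \<phi>) =
     of_real (fact CARD('d) * (\<Sum>n\<in>UNIV. h $ n * (norm (column n Q))\<^sup>2))" by simp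
  then show ?thesis by (simp only: of_real_eq_iff)
qed

lemma orthonormal_rows_minor:
  fixes Q :: "complex^'n^'d"
  assumes Q: "Q ** conj_transpose Q = mat 1"
  shows "\<exists>\<phi>. minor Q \<phi> \<noteq> 0"
proof (rule ccontr)
  assume "\<nexists>\<phi>. minor Q \<phi> \<noteq> 0"
  then have w: "weight Q \<phi> = 0" for \<phi> by simp
  then have "(\<Sum>n\<in>UNIV. (norm (column n Q))\<^sup>2) = 0"
    using weighted_column_norms[OF Q, of 1] unfolding w by simp
  then show False using sum_column_norms[OF Q] by simp
qed

text \<open>
  Adding a constant to \<open>y\<close> only multiplies all columns by a common factor, so the scaling exponents are
  normalized to have sum zero.
\<close>

definition zero_sum :: "(real^'n) set" where
  "zero_sum = {h. (\<Sum>n\<in>UNIV. h $ n) = 0}"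

lemma zero_sum_0 [simp]: "0 \<in> zero_sum"
  by (simp add: zero_sum_def)

lemma zero_sum_add: "a \<in> zero_sum \<Longrightarrow> b \<in> zero_sum \<Longrightarrow> a + b \<in> zero_sum"
  by (simp add: zero_sum_def sum.distrib)

lemma zero_sum_scaleR: "a \<in> zero_sum \<Longrightarrow> c *\<^sub>R a \<in> zero_sum"
  by (simp add: zero_sum_def sum_distrib_left[symmetric])

lemma zero_sum_diff: "a \<in> zero_sum \<Longrightarrow> b \<in> zero_sum \<Longrightarrow> a - b \<in> zero_sum"
  by (simp add: zero_sum_def sum_subtractf)

lemma closed_zero_sum: "closed zero_sum"
  unfolding zero_sum_def by (intro closed_Collect_eq continuous_intros)

text \<open>
  The test vectors \<open>e\<^sub>m - e\<^sub>n\<close> compare two column norms, and the total of the squared norms is \<open>d\<close>.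
\<close>

lemma equal_column_norms:
  fixes Q :: "complex^'n^'d"
  assumes Q: "Q ** conj_transpose Q = mat 1"
    and crit: "\<And>h. h \<in> zero_sum \<Longrightarrow> (\<Sum>\<phi>\<in>UNIV. sum_along h \<phi> * weight Q \<phi>) = 0"
  shows "(norm (column n Q))\<^sup>2 = real CARD('d) / real CARD('n)"
proof -
  let ?a = "\<lambda>n. (norm (column n Q))\<^sup>2"
  have eq: "?a m = ?a n" for m
  proof -
    let ?h = "axis m 1 - axis n 1 :: real^'n"
    have "?h \<in> zero_sum" by (simp add: zero_sum_def sum_subtractf axis_def)
    from crit[OF this] weighted_column_norms[OF Q, of ?h]
    have "(\<Sum>k\<in>UNIV. ?h $ k * ?a k) = 0" by simp
    then show ?thesis by (simp add: axis_def left_diff_distrib sum_subtractf if_distrib[of "\<lambda>x. x * _"] cong: if_cong)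
  qed
  have "real CARD('d) = (\<Sum>m\<in>UNIV. ?a m)" using sum_column_norms[OF Q] by simp
  also have "\<dots> = (\<Sum>m\<in>(UNIV::'n set). ?a n)" by (rule sum.cong[OF refl eq])
  also have "\<dots> = real CARD('n) * ?a n" by simp
  finally show ?thesis by (simp add: field_simps)
qed

lemma equal_column_norms_critical:
  fixes Q :: "complex^'n^'d"
  assumes Q: "Q ** conj_transpose Q = mat 1" and r: "\<And>n. (norm (column n Q))\<^sup>2 = r"
    and h: "h \<in> zero_sum"
  shows "(\<Sum>\<phi>\<in>UNIV. sum_along h \<phi> * weight Q \<phi>) = 0"
  unfolding weighted_column_norms[OF Q] r using h
  by (simp add: zero_sum_def sum_distrib_right[symmetric])

section \<open>FUNTFs as rescaled matrices with orthonormal rows\<close>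

lemma FUNTF_scaled_iff:
  fixes Q :: "complex^'n^'d"
  defines "s \<equiv> sqrt (real CARD('n) / real CARD('d))"
  shows "s *\<^sub>R Q \<in> FUNTF \<longleftrightarrow> Q ** conj_transpose Q = mat 1 \<and>
    (\<forall>n. (norm (column n Q))\<^sup>2 = real CARD('d) / real CARD('n))"
proof -
  have s: "s > 0" "s\<^sup>2 = real CARD('n) / real CARD('d)" by (simp_all add: s_def)
  have "column n (s *\<^sub>R Q) = s *\<^sub>R column n Q" for n
    by (simp add: column_def vec_eq_iff)
  then have "norm (column n (s *\<^sub>R Q)) = 1 \<longleftrightarrow> s\<^sup>2 * (norm (column n Q))\<^sup>2 = 1" for n
    using s(1) by (simp add: power_mult_distrib[symmetric] abs_square_eq_1)
  then have 1: "norm (column n (s *\<^sub>R Q)) = 1 \<longleftrightarrow> (norm (column n Q))\<^sup>2 = real CARD('d) / real CARD('n)" for n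
    unfolding s(2) eq_divide_eq by (simp add: mult.commute eq_commute[of "real CARD('d)"])
  have "(s *\<^sub>R Q) ** conj_transpose (s *\<^sub>R Q) = (s\<^sup>2) *\<^sub>R (Q ** conj_transpose Q)"
  proof -
    have "herm (s *\<^sub>R u) (s *\<^sub>R v) = (s\<^sup>2) *\<^sub>R herm u v" for u v :: "complex^'n"
      unfolding herm_def vector_scaleR_component
      by (simp add: scaleR_conv_of_real sum_distrib_left power2_eq_square mult_ac)
    then show ?thesis by (simp add: vec_eq_iff frame_operator_entry)
  qed
  moreover have "(mat (of_nat CARD('n) / of_nat CARD('d)) :: complex^'d^'d) = (s\<^sup>2) *\<^sub>R mat 1"
    unfolding vec_eq_iff vector_scaleR_component s(2) by (simp add: mat_def scaleR_conv_of_real)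
  ultimately have 2: "(s *\<^sub>R Q) ** conj_transpose (s *\<^sub>R Q) = mat (of_nat CARD('n) / of_nat CARD('d))
      \<longleftrightarrow> Q ** conj_transpose Q = mat 1"
    using s by simp
  show ?thesis unfolding FUNTF_def using 1 2 by blast
qed

lemma FUNTF_rescale:
  fixes F :: "complex^'n^'d"
  assumes "F \<in> FUNTF"
  obtains s Q where "s > 0" "s\<^sup>2 = real CARD('n) / real CARD('d)" "F = s *\<^sub>R Q"
    "Q ** conj_transpose Q = mat 1" "\<And>n. (norm (column n Q))\<^sup>2 = real CARD('d) / real CARD('n)"
proof -
  define s where "s = sqrt (real CARD('n) / real CARD('d))"
  have s: "s > 0" "s\<^sup>2 = real CARD('n) / real CARD('d)" by (simp_all add: s_def)
  define Q where "Q = inverse s *\<^sub>R F"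
  have F: "F = s *\<^sub>R Q" using s(1) by (simp add: Q_def)
  show thesis
    using assms that[OF s F] FUNTF_scaled_iff[of Q] unfolding F s_def by blast
qed

lemma FUNTF_has_minor:
  fixes F :: "complex^'n^'d"
  assumes "F \<in> FUNTF"
  shows "\<exists>\<phi>. minor F \<phi> \<noteq> 0"
proof -
  from assms obtain s Q where s: "s > 0" and s2: "s\<^sup>2 = real CARD('n) / real CARD('d)"
    and F: "F = s *\<^sub>R Q" and Q: "Q ** conj_transpose Q = mat 1"
    and n: "\<And>n. (norm (column n Q))\<^sup>2 = real CARD('d) / real CARD('n)"
    by (rule FUNTF_rescale) (rule that)
  show ?thesis using orthonormal_rows_minor[OF Q] s by (simp add: F minor_scaleR)
qed

text \<open>
  In terms of \<open>potential\<close> below: for a FUNTF the origin is a critical point.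
\<close>

lemma FUNTF_critical:
  fixes F :: "complex^'n^'d"
  assumes "F \<in> FUNTF" and h: "h \<in> zero_sum"
  shows "(\<Sum>\<phi>\<in>UNIV. sum_along h \<phi> * weight F \<phi>) = 0"
proof -
  from assms(1) obtain s Q where s: "s > 0" and s2: "s\<^sup>2 = real CARD('n) / real CARD('d)"
    and F: "F = s *\<^sub>R Q" and Q: "Q ** conj_transpose Q = mat 1"
    and n: "\<And>n. (norm (column n Q))\<^sup>2 = real CARD('d) / real CARD('n)"
    by (rule FUNTF_rescale) (rule that)
  have "(\<Sum>\<phi>\<in>UNIV. sum_along h \<phi> * weight Q \<phi>) = 0"
    by (rule equal_column_norms_critical[OF Q n h])
  moreover have "weight F \<phi> = (s ^ CARD('d))\<^sup>2 * weight Q \<phi>" for \<phi>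
    using s unfolding F weight_def minor_scaleR norm_mult norm_of_real by (simp add: power_mult_distrib)
  then have "(\<Sum>\<phi>\<in>UNIV. sum_along h \<phi> * weight F \<phi>)
      = (s ^ CARD('d))\<^sup>2 * (\<Sum>\<phi>\<in>UNIV. sum_along h \<phi> * weight Q \<phi>)"
    by (simp add: sum_distrib_left mult_ac)
  ultimately show ?thesis by simp
qed

lemma FUNTF_sum_squared_correlations:
  fixes F :: "complex^'n^'d"
  assumes "F \<in> FUNTF"
  shows "(\<Sum>m\<in>UNIV. (cmod (herm (column m F) (column n F)))\<^sup>2) = real CARD('n) / real CARD('d)"
proof -
  from assms obtain s Q where s: "s > 0" and s2: "s\<^sup>2 = real CARD('n) / real CARD('d)"
    and F: "F = s *\<^sub>R Q" and Q: "Q ** conj_transpose Q = mat 1"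
    and n: "\<And>n. (norm (column n Q))\<^sup>2 = real CARD('d) / real CARD('n)"
    by (rule FUNTF_rescale) (rule that)
  have col: "column k F = of_real s *s column k Q" for k
    by (simp add: F column_def vec_eq_iff scaleR_conv_of_real[symmetric])
  have "(cmod (herm (column m F) (column n F)))\<^sup>2 = (s\<^sup>2)\<^sup>2 * (cmod (herm (column m Q) (column n Q)))\<^sup>2" for m
    by (simp add: col herm_smult_left herm_smult_right norm_mult power_mult_distrib power2_eq_square)
  then have "(\<Sum>m\<in>UNIV. (cmod (herm (column m F) (column n F)))\<^sup>2) = (s\<^sup>2)\<^sup>2 * (norm (column n Q))\<^sup>2"
    by (simp add: sum_distrib_left[symmetric] sum_squared_correlations[OF Q])
  also have "\<dots> = real CARD('n) / real CARD('d)"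
    unfolding s2 n by (simp add: power2_eq_square)
  finally show ?thesis .
qed

section \<open>Continuous orthonormalization of rows\<close>

lemma continuous_on_matrix_mult:
  fixes f :: "'a::topological_space \<Rightarrow> complex^'n^'m" and g :: "'a \<Rightarrow> complex^'k^'n"
  assumes "continuous_on S f" "continuous_on S g"
  shows "continuous_on S (\<lambda>x. f x ** g x)"
  unfolding matrix_matrix_mult_def by (intro continuous_intros assms)

lemma minor_zero_if_rows_dependent:
  fixes R :: "complex^'n^'d"
  assumes u: "u \<noteq> 0" and 0: "(\<Sum>j\<in>UNIV. u $ j *s R $ j) = 0"
  shows "minor R \<phi> = 0"
proof (rule ccontr)
  let ?M = "\<chi> i j. R $ j $ \<phi> i"
  assume "minor R \<phi> \<noteq> 0"
  then have "invertible ?M" unfolding minor_def by (simp add: invertible_det_nz)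
  moreover have "?M *v u = 0"
  proof -
    have "(\<Sum>j\<in>UNIV. u $ j *s R $ j) $ \<phi> i = 0" for i using 0 by simp
    then show ?thesis by (simp add: matrix_vector_mult_def vec_eq_iff mult.commute)
  qed
  ultimately show False using u
    by (metis matrix_left_invertible_ker invertible_def)
qed

text \<open>
  Gram-Schmidt as a left multiplication by a continuous family of invertible matrices. The index type
  of the rows carries no order, so the rows are treated one at a time along a finite set \<open>A\<close>; the rows
  in \<open>A\<close> are already orthonormal. Rows that are orthonormal from the start are left
  alone, which is what later makes the retraction fix the FUNTFs.
\<close>

lemma row_orthonormalization:
  fixes B :: "'a::topological_space \<Rightarrow> complex^'n^'d"
  assumes cont: "continuous_on S B" and span: "\<And>x. x \<in> S \<Longrightarrow> \<exists>\<phi>. minor (B x) \<phi> \<noteq> 0"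
  shows "\<exists>L. continuous_on S L \<and> (\<forall>x\<in>S. det (L x) \<noteq> 0 \<and>
    (L x ** B x) ** conj_transpose (L x ** B x) = mat 1 \<and>
    (B x ** conj_transpose (B x) = mat 1 \<longrightarrow> L x = mat 1))"
proof -
  have "\<exists>L. continuous_on S L \<and> (\<forall>x\<in>S. det (L x) \<noteq> 0 \<and>
      (\<forall>i\<in>A. \<forall>j\<in>A. herm ((L x ** B x) $ i) ((L x ** B x) $ j) = (if i = j then 1 else 0)) \<and>
      (B x ** conj_transpose (B x) = mat 1 \<longrightarrow> L x = mat 1))" if "finite A" for A :: "'d set"
    using that
  proof (induction A rule: finite_induct)
    case empty
    show ?case by (rule exI[of _ "\<lambda>_. mat 1"]) simp
  next
    case (insert k A)
    then obtain L where Lc: "continuous_on S L" and Ld: "\<And>x. x \<in> S \<Longrightarrow> det (L x) \<noteq> 0"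
      and Lo: "\<And>x i j. x \<in> S \<Longrightarrow> i \<in> A \<Longrightarrow> j \<in> A \<Longrightarrow>
        herm ((L x ** B x) $ i) ((L x ** B x) $ j) = (if i = j then 1 else 0)"
      and L1: "\<And>x. x \<in> S \<Longrightarrow> B x ** conj_transpose (B x) = mat 1 \<Longrightarrow> L x = mat 1"
      by blast
    define R where "R x = L x ** B x" for x
    \<comment> \<open>\<open>r\<close> is the component of the row \<open>k\<close> orthogonal to the rows in \<open>A\<close>, \<open>u\<close> holds its coefficients,
      and \<open>E\<close> replaces the row \<open>k\<close> by the normalized \<open>r\<close>.\<close>
    define u where "u x = (\<chi> j. if j = k then 1 else if j \<in> A then - herm (R x $ k) (R x $ j) else 0)" for x
    define r where "r x = R x $ k - (\<Sum>j\<in>A. herm (R x $ k) (R x $ j) *s R x $ j)" for x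
    define E :: "'a \<Rightarrow> complex^'d^'d" where
      "E x = (\<chi> i j. if i = k then of_real (inverse (norm (r x))) * u x $ j else if i = j then 1 else 0)" for x
    have Rc: "continuous_on S R"
      unfolding R_def by (intro continuous_on_matrix_mult Lc cont)
    have hc: "continuous_on S (\<lambda>x. herm (R x $ i) (R x $ j))" for i j
      unfolding herm_def by (intro continuous_intros Rc)
    have rc: "continuous_on S r"
      unfolding r_def vector_scalar_mult_def by (intro continuous_intros Rc hc)
    have ru: "(\<Sum>j\<in>UNIV. u x $ j *s R x $ j) = r x" for x
    proof -
      have "(\<Sum>j\<in>UNIV. u x $ j *s R x $ j) = (\<Sum>j\<in>insert k A. u x $ j *s R x $ j)"
        by (rule sum.mono_neutral_right) (auto simp: u_def)
      also have "\<dots> = R x $ k + (\<Sum>j\<in>A. u x $ j *s R x $ j)"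
        using insert.hyps by (simp add: u_def)
      also have "(\<Sum>j\<in>A. u x $ j *s R x $ j) = (\<Sum>j\<in>A. - (herm (R x $ k) (R x $ j) *s R x $ j))"
        using insert.hyps by (intro sum.cong refl) (auto simp: u_def vec_eq_iff)
      finally show ?thesis unfolding r_def sum_negf by simp
    qed
    \<comment> \<open>\<open>r = 0\<close> would be a linear dependence between the rows, which a nonzero minor rules out.\<close>
    have r0: "r x \<noteq> 0" if "x \<in> S" for x
    proof
      assume "r x = 0"
      moreover have "u x $ k = 1" by (simp add: u_def)
      then have "u x \<noteq> 0" by auto
      ultimately have "minor (R x) \<phi> = 0" for \<phi>
        using minor_zero_if_rows_dependent[of "u x" "R x"] ru by simp
      then show False
        using span[OF that] Ld[OF that] by (simp add: R_def minor_mult)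
    qed
    have Ec: "continuous_on S E"
    proof -
      have "continuous_on S (\<lambda>x. u x $ j)" for j
        unfolding u_def by (cases "j = k"; cases "j \<in> A") (auto intro!: continuous_intros hc)
      moreover have "continuous_on S (\<lambda>x. complex_of_real (inverse (norm (r x))))"
        by (intro continuous_intros rc) (auto simp: r0)
      ultimately have "continuous_on S (\<lambda>x. of_real (inverse (norm (r x))) * u x $ j)" for j
        by (intro continuous_on_mult) auto
      then have "continuous_on S (\<lambda>x. E x $ i $ j)" for i j
        unfolding E_def by (cases "i = k") auto
      then have "continuous_on S (\<lambda>x. \<chi> i j. E x $ i $ j)" by (intro continuous_on_vec_lambda)
      then show ?thesis by simp
    qed
    have detE: "det (E x) = of_real (inverse (norm (r x)))" for x
    proof -
      let ?v = "of_real (inverse (norm (r x))) *s u x"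
      have v: "(\<Sum>i\<in>UNIV. ?v $ i *s row i (mat 1)) = ?v"
        by (simp add: vec_eq_iff row_def mat_def if_distrib cong: if_cong)
      have "E x = (\<chi> i. if i = k then (\<Sum>i\<in>UNIV. ?v $ i *s row i (mat 1)) else row i (mat 1))"
        unfolding v by (auto simp: vec_eq_iff E_def row_def mat_def)
      then have "det (E x) = ?v $ k"
        by (simp only: cramer_lemma_transpose det_I mult_1_right)
      then show ?thesis by (simp add: u_def)
    qed
    have ER: "(E x ** R x) $ i = (if i = k then of_real (inverse (norm (r x))) *s r x else R x $ i)" for x i
    proof (cases "i = k")
      case True
      have "(E x ** R x) $ k = of_real (inverse (norm (r x))) *s (\<Sum>j\<in>UNIV. u x $ j *s R x $ j)"
        by (simp add: vec_eq_iff matrix_matrix_mult_def E_def sum_distrib_left mult.assoc)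
      then show ?thesis using True ru by simp
    next
      case False
      then show ?thesis
        by (simp add: vec_eq_iff matrix_matrix_mult_def E_def if_distrib[of "\<lambda>z. z * _"] cong: if_cong)
    qed
    have ELB: "(E x ** L x) ** B x = E x ** R x" for x
      by (simp add: R_def matrix_mul_assoc)
    have orth: "herm (r x) (R x $ j) = 0" if "x \<in> S" "j \<in> A" for x j
    proof -
      have "herm (r x) (R x $ j) = herm (R x $ k) (R x $ j)
         - (\<Sum>i\<in>A. herm (R x $ k) (R x $ i) * herm (R x $ i) (R x $ j))"
        by (simp add: r_def herm_diff_left herm_sum_left herm_smult_left)
      also have "(\<Sum>i\<in>A. herm (R x $ k) (R x $ i) * herm (R x $ i) (R x $ j))
         = (\<Sum>i\<in>A. if i = j then herm (R x $ k) (R x $ i) else 0)"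
        using Lo[OF that(1) _ that(2)] by (intro sum.cong) (auto simp: R_def)
      finally show ?thesis using that insert.hyps by simp
    qed
    have orth': "herm (R x $ j) (r x) = 0" if "x \<in> S" "j \<in> A" for x j
      using orth[OF that] herm_cnj[of "r x" "R x $ j"] by simp
    have unit: "herm (of_real (inverse (norm (r x))) *s r x) (of_real (inverse (norm (r x))) *s r x) = 1"
      if "x \<in> S" for x
      using r0[OF that] unfolding herm_smult_left herm_smult_right herm_self[of "r x"]
      by (simp add: power2_eq_square field_simps)
    have one: "E x = mat 1" if x: "x \<in> S" and B1: "B x ** conj_transpose (B x) = mat 1" for x
    proof -
      have R: "R x = B x" using L1[OF x B1] by (simp add: R_def)
      have h: "herm (R x $ i) (R x $ j) = (if i = j then 1 else 0)" for i j
        using B1 unfolding orthonormal_rows_iff R by simp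
      have "(\<Sum>j\<in>A. herm (R x $ k) (R x $ j) *s R x $ j) = 0"
        using insert.hyps by (intro sum.neutral ballI) (auto simp: h vec_eq_iff)
      then have "r x = R x $ k" by (simp add: r_def)
      moreover have "(norm (R x $ k))\<^sup>2 = 1"
        using h[of k k] unfolding herm_self by (simp del: of_real_power)
      ultimately have "norm (r x) = 1" by (simp add: abs_square_eq_1)
      moreover have "u x = (\<chi> j. if j = k then 1 else 0)"
        by (auto simp: u_def h vec_eq_iff)
      ultimately show ?thesis by (auto simp: vec_eq_iff E_def mat_def)
    qed
    show ?case
    proof (intro exI[of _ "\<lambda>x. E x ** L x"] conjI ballI impI)
      show "continuous_on S (\<lambda>x. E x ** L x)"
        by (intro continuous_on_matrix_mult Ec Lc)
    next
      fix x assume x: "x \<in> S"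
      show "det (E x ** L x) \<noteq> 0" using r0[OF x] Ld[OF x] by (simp add: det_mul detE)
    next
      fix x i j assume x: "x \<in> S" "i \<in> insert k A" "j \<in> insert k A"
      then show "herm ((E x ** L x ** B x) $ i) ((E x ** L x ** B x) $ j) = (if i = j then 1 else 0)"
        using insert.hyps unit[OF x(1)] orth[OF x(1)] orth'[OF x(1)] Lo[OF x(1)]
        unfolding ELB ER by (auto simp: herm_smult_left herm_smult_right R_def)
    next
      fix x assume x: "x \<in> S" and B1: "B x ** conj_transpose (B x) = mat 1"
      then show "E x ** L x = mat 1" using one L1 by simp
    qed
  qed
  from this[OF finite_class.finite_UNIV] show ?thesis
    unfolding orthonormal_rows_iff by simp
qed

section \<open>Connectedness of sets defined by nonvanishing minors\<close>

definition complex_line :: "complex^'n^'d \<Rightarrow> complex^'n^'d \<Rightarrow> complex \<Rightarrow> complex^'n^'d" where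
  "complex_line F G z = (\<chi> i n. F $ i $ n + z * (G $ i $ n - F $ i $ n))"

lemma minor_complex_line_poly: "\<exists>p. \<forall>z. poly p z = minor (complex_line F G z) \<phi>"
proof -
  define p where "p = (\<Sum>\<sigma> | \<sigma> permutes UNIV. of_int (sign \<sigma>) *
    (\<Prod>i\<in>UNIV. [:F $ \<sigma> i $ \<phi> i, G $ \<sigma> i $ \<phi> i - F $ \<sigma> i $ \<phi> i:]))"
  have "poly p z = minor (complex_line F G z) \<phi>" for z
    by (simp add: p_def minor_def det_def complex_line_def poly_sum poly_prod of_int_poly)
  then show ?thesis by blast
qed

text \<open>
  A minor that is nonzero at \<open>z0\<close> is a nonzero polynomial along the line.
\<close>

lemma finite_lost_minors: "finite {z. \<exists>\<phi>. minor (complex_line F G z0) \<phi> \<noteq> 0 \<and> minor (complex_line F G z) \<phi> = 0}"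
proof -
  have "finite {z. minor (complex_line F G z0) \<phi> \<noteq> 0 \<and> minor (complex_line F G z) \<phi> = 0}" for \<phi>
  proof -
    obtain p where p: "\<And>z. poly p z = minor (complex_line F G z) \<phi>"
      using minor_complex_line_poly[of F G \<phi>] by auto
    show ?thesis
    proof (cases "poly p z0 = 0")
      case False
      then have "p \<noteq> 0" by auto
      then show ?thesis using poly_roots_finite[of p] by (auto simp: p[symmetric])
    qed (simp add: p[symmetric])
  qed
  then have "finite (\<Union>\<phi>\<in>UNIV. {z. minor (complex_line F G z0) \<phi> \<noteq> 0 \<and> minor (complex_line F G z) \<phi> = 0})"
    by (intro finite_UN_I) auto
  then show ?thesis by (rule finite_subset[rotated]) auto
qed

text \<open>
  Both points are joined, inside the complex line through them, to a third point that retains the nonzero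
  minors of each of them. Over the complex numbers this line stays path-connected
  when the finitely many bad points are removed.
\<close>

lemma path_connected_minor_support:
  fixes \<Omega> :: "(complex^'n^'d) set"
  assumes mono: "\<And>F G. F \<in> \<Omega> \<Longrightarrow> (\<And>\<phi>. minor F \<phi> \<noteq> 0 \<Longrightarrow> minor G \<phi> \<noteq> 0) \<Longrightarrow> G \<in> \<Omega>"
  shows "path_connected \<Omega>"
  unfolding path_connected_component
proof (intro ballI)
  fix F G assume FG: "F \<in> \<Omega>" "G \<in> \<Omega>"
  let ?l = "complex_line F G"
  \<comment> \<open>The points of the line at which some minor that is nonzero at \<open>w\<close> is lost.\<close>
  define bad where "bad w = {z. \<exists>\<phi>. minor (?l w) \<phi> \<noteq> 0 \<and> minor (?l z) \<phi> = 0}" for w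
  have fin: "finite (bad w)" for w unfolding bad_def by (rule finite_lost_minors)
  have cont: "continuous_on S ?l" for S
    unfolding complex_line_def by (intro continuous_intros)
  have l01: "?l 0 = F" "?l 1 = G" by (simp_all add: complex_line_def vec_eq_iff)
  have comp: "path_component \<Omega> (?l w) (?l z)" if "?l w \<in> \<Omega>" "z \<notin> bad w" for w z
  proof -
    have "path_connected (- bad w)"
      by (rule path_connected_complement_countable) (auto simp: fin countable_finite)
    then have "path_connected (?l ` (- bad w))"
      by (intro path_connected_continuous_image cont)
    moreover have "w \<in> - bad w" by (auto simp: bad_def)
    ultimately have "path_component (?l ` (- bad w)) (?l w) (?l z)"
      using that by (auto simp: path_connected_component)
    moreover have "?l ` (- bad w) \<subseteq> \<Omega>"
      using mono[OF that(1)] by (auto simp: bad_def)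
    ultimately show ?thesis using path_component_of_subset by blast
  qed
  obtain z where "z \<notin> bad 0 \<union> bad 1"
    using ex_new_if_finite[OF infinite_UNIV_char_0, of "bad 0 \<union> bad 1"] fin by auto
  then have "path_component \<Omega> F (?l z)" "path_component \<Omega> G (?l z)"
    using comp[of 0 z] comp[of 1 z] FG l01 by auto
  then show "path_component \<Omega> F G"
    by (meson path_component_sym path_component_trans)
qed

section \<open>Paths of FUNTFs obtained by scaling\<close>

text \<open>
  The assumption \<open>crit\<close> makes the columns of \<open>F\<close>, scaled by \<open>exp (y\<^sub>n / 2)\<close> and made into a matrix with
  orthonormal rows, equally long. So \<open>F\<close> is mapped continuously to a FUNTF, and by \<open>y0\<close> the FUNTFs in
  \<open>\<Omega>\<close> are fixed. Paths in \<open>\<Omega>\<close> are thereby mapped to paths of FUNTFs with the same endpoints.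
\<close>

lemma FUNTF_path_by_retraction:
  fixes \<Omega> :: "(complex^'n^'d) set" and y :: "complex^'n^'d \<Rightarrow> real^'n"
  assumes \<Omega>: "path_connected \<Omega>"
    and span: "\<And>F. F \<in> \<Omega> \<Longrightarrow> \<exists>\<phi>. minor F \<phi> \<noteq> 0"
    and y: "continuous_on \<Omega> y"
    and crit: "\<And>F h. F \<in> \<Omega> \<Longrightarrow> h \<in> zero_sum \<Longrightarrow>
       (\<Sum>\<phi>\<in>UNIV. sum_along h \<phi> * (exp (sum_along (y F) \<phi>) * weight F \<phi>)) = 0"
    and y0: "\<And>F. F \<in> \<Omega> \<Longrightarrow> F \<in> FUNTF \<Longrightarrow> y F = 0"
    and FG: "F \<in> \<Omega>" "G \<in> \<Omega>" "F \<in> FUNTF" "G \<in> FUNTF"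
  shows "path_component FUNTF F G"
proof -
  define s where "s = sqrt (real CARD('n) / real CARD('d))"
  have s: "s > 0" by (simp add: s_def)
  \<comment> \<open>The factor \<open>1 / s\<close> gives \<open>B F\<close> orthonormal rows when \<open>F\<close> is a FUNTF, so that \<open>L F = 1\<close> there.\<close>
  define B where "B F = colscale (\<lambda>n. exp (y F $ n / 2) / s) F" for F :: "complex^'n^'d"
  have minorB: "minor (B F) \<phi> = of_real (exp (sum_along (y F) \<phi> / 2) / s ^ CARD('d)) * minor F \<phi>" for F \<phi>
    by (simp add: B_def minor_colscale sum_along_def exp_sum sum_divide_distrib prod_dividef)
  have Bc: "continuous_on \<Omega> B"
    unfolding B_def colscale_def using s by (intro continuous_intros y) auto
  have Bs: "\<exists>\<phi>. minor (B F) \<phi> \<noteq> 0" if "F \<in> \<Omega>" for F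
    using span[OF that] s by (simp add: minorB)
  obtain L where Lc: "continuous_on \<Omega> L"
    and Lo: "\<And>F. F \<in> \<Omega> \<Longrightarrow> (L F ** B F) ** conj_transpose (L F ** B F) = mat 1"
    and L1: "\<And>F. F \<in> \<Omega> \<Longrightarrow> B F ** conj_transpose (B F) = mat 1 \<Longrightarrow> L F = mat 1"
    using row_orthonormalization[OF Bc Bs] by blast
  define R where "R F = s *\<^sub>R (L F ** B F)" for F
  have "continuous_on \<Omega> R"
    unfolding R_def by (intro continuous_on_scaleR continuous_on_const continuous_on_matrix_mult Lc Bc)
  then have pc: "path_connected (R ` \<Omega>)" using \<Omega> by (rule path_connected_continuous_image)
  have "R F \<in> FUNTF" if F: "F \<in> \<Omega>" for F
  proof -
    let ?k = "(cmod (det (L F)))\<^sup>2 / (s ^ CARD('d))\<^sup>2"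
    have w: "weight (L F ** B F) \<phi> = ?k * (exp (sum_along (y F) \<phi>) * weight F \<phi>)" for \<phi>
    proof -
      have e: "(exp (p / 2))\<^sup>2 = exp p" for p :: real
        unfolding exp_double[symmetric] by simp
      have "cmod (minor (L F ** B F) \<phi>)
          = cmod (det (L F)) * (exp (sum_along (y F) \<phi> / 2) / s ^ CARD('d) * cmod (minor F \<phi>))"
        using s unfolding minor_mult minorB norm_mult norm_of_real by simp
      then show ?thesis
        unfolding weight_def by (simp only: power_mult_distrib power_divide e) simp
    qed
    have "(\<Sum>\<phi>\<in>UNIV. sum_along h \<phi> * weight (L F ** B F) \<phi>) = 0" if "h \<in> zero_sum" for h
    proof -
      have "(\<Sum>\<phi>\<in>UNIV. sum_along h \<phi> * weight (L F ** B F) \<phi>)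
          = ?k * (\<Sum>\<phi>\<in>UNIV. sum_along h \<phi> * (exp (sum_along (y F) \<phi>) * weight F \<phi>))"
        unfolding w sum_distrib_left by (intro sum.cong refl) (simp only: mult_ac)
      then show ?thesis using crit[OF F that] by simp
    qed
    from equal_column_norms[OF Lo[OF F] this] show ?thesis
      unfolding R_def s_def FUNTF_scaled_iff using Lo[OF F] by simp
  qed
  then have sub: "R ` \<Omega> \<subseteq> FUNTF" by blast
  have R_id: "R F = F" if F: "F \<in> \<Omega>" "F \<in> FUNTF" for F
  proof -
    have sB: "s *\<^sub>R B F = F"
      using y0[OF F] s unfolding vec_eq_iff vector_scaleR_component
      by (simp add: B_def colscale_def scaleR_conv_of_real)
    have "s *\<^sub>R B F \<in> FUNTF" unfolding sB by (rule F)
    then have "L F = mat 1"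
      unfolding s_def FUNTF_scaled_iff using L1[OF F(1)] by blast
    then show ?thesis using sB by (simp add: R_def)
  qed
  have "path_component (R ` \<Omega>) (R F) (R G)"
    using pc FG by (auto simp: path_connected_component)
  then show ?thesis using R_id[OF FG(1,3)] R_id[OF FG(2,4)] path_component_of_subset[OF sub] by simp
qed

section \<open>The convex potential and its minimizer\<close>

text \<open>
  By the Cauchy-Binet formula this is \<open>d!\<close> times the determinant of \<open>F diag (exp y) F\<^sup>*\<close>.
\<close>

definition potential :: "complex^'n^'d \<Rightarrow> real^'n \<Rightarrow> real" where
  "potential F y = (\<Sum>\<phi>\<in>UNIV. weight F \<phi> * exp (sum_along y \<phi>))"

text \<open>
  Exactly the condition that \<open>potential F\<close> tends to infinity along every ray of the hyperplane. It is
  preserved when more minors become nonzero.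
\<close>

definition stable :: "(complex^'n^'d) set" where
  "stable = {F. \<forall>h\<in>zero_sum. h \<noteq> 0 \<longrightarrow> (\<exists>\<phi>. minor F \<phi> \<noteq> 0 \<and> sum_along h \<phi> > 0)}"

definition is_minimizer :: "complex^'n^'d \<Rightarrow> real^'n \<Rightarrow> bool" where
  "is_minimizer F y \<longleftrightarrow> y \<in> zero_sum \<and> (\<forall>z\<in>zero_sum. potential F y \<le> potential F z)"

lemma tendsto_potential:
  fixes X :: "'a \<Rightarrow> complex^'n^'d"
  assumes X: "(X \<longlongrightarrow> F) net" and Y: "(Y \<longlongrightarrow> y) net"
  shows "((\<lambda>k. potential (X k) (Y k)) \<longlongrightarrow> potential F y) net"
proof -
  have "((\<lambda>k. minor (X k) \<phi>) \<longlongrightarrow> minor F \<phi>) net" for \<phi>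
    unfolding minor_def det_def by (simp, intro tendsto_intros X)
  then show ?thesis
    unfolding potential_def weight_def sum_along_def by (intro tendsto_intros Y)
qed

lemma continuous_on_potential: "continuous_on S (potential F)"
  unfolding continuous_on_def by (auto intro!: tendsto_potential)

text \<open>
  The right-hand side is positively homogeneous and, by stability, positive on the compact unit sphere of
  the hyperplane, where it therefore has a positive minimum.
\<close>

lemma stable_growth:
  fixes F :: "complex^'n^'d"
  assumes "F \<in> stable"
  obtains c where "c > 0"
    "\<And>h. h \<in> zero_sum \<Longrightarrow> c * norm h \<le> (\<Sum>\<phi> | minor F \<phi> \<noteq> 0. max 0 (sum_along h \<phi>))"
proof -
  define m where "m h = (\<Sum>\<phi> | minor F \<phi> \<noteq> 0. max 0 (sum_along h \<phi>))" for h
  let ?K = "zero_sum \<inter> sphere (0::real^'n) 1"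
  have comp: "compact ?K" by (intro closed_Int_compact closed_zero_sum) simp
  have cont: "continuous_on ?K m" unfolding m_def sum_along_def by (intro continuous_intros)
  have pos: "m h > 0" if h: "h \<in> ?K" for h
  proof -
    have "h \<noteq> 0" using h by auto
    then obtain \<phi> where "minor F \<phi> \<noteq> 0" "sum_along h \<phi> > 0"
      using assms h unfolding stable_def by blast
    then show ?thesis unfolding m_def by (intro sum_pos2[of _ \<phi>]) auto
  qed
  have "\<exists>c>0. \<forall>h\<in>?K. c \<le> m h"
  proof (cases "?K = {}")
    case True
    then show ?thesis by (intro exI[of _ 1]) auto
  next
    case False
    from continuous_attains_inf[OF comp this cont] show ?thesis using pos by blast
  qed
  then obtain c where c: "c > 0" "\<And>h. h \<in> ?K \<Longrightarrow> c \<le> m h" by blast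
  have "c * norm h \<le> m h" if h: "h \<in> zero_sum" for h
  proof (cases "h = 0")
    case True
    then show ?thesis by (simp add: m_def sum_nonneg)
  next
    case False
    then have n: "norm h > 0" by simp
    have "c \<le> m ((1 / norm h) *\<^sub>R h)"
      using n by (intro c(2)) (auto intro: zero_sum_scaleR h)
    also have "\<dots> = m h / norm h"
    proof -
      have "max 0 (sum_along h \<phi> / norm h) = max 0 (sum_along h \<phi>) / norm h" for \<phi> :: "'d \<Rightarrow> 'n"
        using n by (simp add: max_def divide_le_0_iff zero_le_divide_iff)
      then show ?thesis unfolding m_def sum_along_scaleR by (simp add: sum_divide_distrib)
    qed
    finally show ?thesis using n by (simp add: pos_le_divide_eq)
  qed
  then show thesis using that c(1) unfolding m_def by blast
qed

text \<open>
  The sublevel set of \<open>potential F 0\<close> is compact: on it every \<open>sum_along y \<phi>\<close> with a nonzero minor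
  is bounded above, hence so is \<open>y\<close> by \<open>stable_growth\<close>.
\<close>

lemma minimizer_exists:
  fixes F :: "complex^'n^'d"
  assumes "F \<in> stable"
  shows "\<exists>y. is_minimizer F y"
proof -
  obtain c where c: "c > 0"
    "\<And>h. h \<in> zero_sum \<Longrightarrow> c * norm h \<le> (\<Sum>\<phi> | minor F \<phi> \<noteq> 0. max 0 (sum_along h \<phi>))"
    using stable_growth[OF assms] by metis
  let ?K = "zero_sum \<inter> {y. potential F y \<le> potential F 0}"
  define b where "b = (\<Sum>\<phi> | minor F \<phi> \<noteq> 0. max 0 (ln (potential F 0 / weight F \<phi>)))"
  have bound: "norm y \<le> b / c" if y: "y \<in> ?K" for y
  proof -
    have "sum_along y \<phi> \<le> ln (potential F 0 / weight F \<phi>)" if \<phi>: "minor F \<phi> \<noteq> 0" for \<phi>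
    proof -
      have w: "weight F \<phi> > 0" using \<phi> weight_nonneg[of F \<phi>] weight_eq_0_iff[of F \<phi>] by linarith
      have "weight F \<phi> * exp (sum_along y \<phi>) \<le> potential F y"
        unfolding potential_def by (rule member_le_sum) auto
      then have "exp (sum_along y \<phi>) \<le> potential F 0 / weight F \<phi>"
        using y w by (simp add: pos_le_divide_eq mult.commute)
      then show ?thesis by (metis exp_gt_zero ln_exp ln_mono order_less_le_trans)
    qed
    then have "(\<Sum>\<phi> | minor F \<phi> \<noteq> 0. max 0 (sum_along y \<phi>)) \<le> b"
      unfolding b_def by (intro sum_mono max.mono) auto
    then have "c * norm y \<le> b" using c(2)[of y] y by simp
    then show ?thesis using c(1) by (simp add: pos_le_divide_eq mult.commute)
  qed
  have "closed ?K"
    by (intro closed_Int closed_zero_sum closed_Collect_le continuous_on_potential continuous_on_const)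
  moreover have "bounded ?K" using bound bounded_iff by blast
  ultimately have "compact ?K" by (simp add: compact_eq_bounded_closed)
  moreover have "0 \<in> ?K" by simp
  ultimately obtain y where y: "y \<in> ?K" "\<And>z. z \<in> ?K \<Longrightarrow> potential F y \<le> potential F z"
    using continuous_attains_inf[of ?K "potential F"] continuous_on_potential by blast
  have "potential F y \<le> potential F z" if "z \<in> zero_sum" for z
    using y(1) y(2)[of z] that by (cases "potential F z \<le> potential F 0") auto
  then show ?thesis using y(1) unfolding is_minimizer_def by blast
qed

lemma potential_convex:
  assumes "0 \<le> t" "t \<le> 1"
  shows "potential F ((1 - t) *\<^sub>R y + t *\<^sub>R z) \<le> (1 - t) * potential F y + t * potential F z"
proof -
  have "exp (sum_along ((1 - t) *\<^sub>R y + t *\<^sub>R z) \<phi>) \<le> (1 - t) * exp (sum_along y \<phi>) + t * exp (sum_along z \<phi>)" for \<phi>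
    using convex_onD[OF exp_convex, of t "sum_along y \<phi>" "sum_along z \<phi>"] assms
    by (simp add: sum_along_add sum_along_scaleR)
  then have "potential F ((1 - t) *\<^sub>R y + t *\<^sub>R z)
      \<le> (\<Sum>\<phi>\<in>UNIV. weight F \<phi> * ((1 - t) * exp (sum_along y \<phi>) + t * exp (sum_along z \<phi>)))"
    unfolding potential_def by (intro sum_mono mult_left_mono) auto
  also have "\<dots> = (1 - t) * potential F y + t * potential F z"
    by (simp add: potential_def sum_distrib_left sum.distrib distrib_left mult_ac)
  finally show ?thesis .
qed

text \<open>
  By stability some exponential with positive weight takes different values at the two minimizers, so the
  potential is strictly convex between them and their midpoint would be better.
\<close>

lemma minimizer_unique:
  fixes F :: "complex^'n^'d"
  assumes F: "F \<in> stable" and y: "is_minimizer F y" and z: "is_minimizer F z"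
  shows "y = z"
proof (rule ccontr)
  assume "y \<noteq> z"
  then have "z - y \<noteq> 0" "z - y \<in> zero_sum"
    using y z zero_sum_diff by (auto simp: is_minimizer_def)
  then obtain \<psi> where \<psi>: "minor F \<psi> \<noteq> 0" "sum_along (z - y) \<psi> > 0"
    using F unfolding stable_def by blast
  have "sum_along (z - y) \<psi> = sum_along z \<psi> - sum_along y \<psi>"
    by (simp add: sum_along_def sum_subtractf)
  with \<psi> have \<psi>': "sum_along y \<psi> < sum_along z \<psi>" "weight F \<psi> > 0"
    using weight_nonneg[of F \<psi>] weight_eq_0_iff[of F \<psi>] by linarith+
  define w where "w = (1/2) *\<^sub>R (y + z)"
  have w: "w \<in> zero_sum"
    using y z by (auto simp: w_def is_minimizer_def intro: zero_sum_add zero_sum_scaleR)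
  \<comment> \<open>The convexity defect of \<open>exp\<close> at the midpoint is half a square.\<close>
  have split: "(exp a + exp b) / 2 - exp ((a + b) / 2) = (exp (a / 2) - exp (b / 2))\<^sup>2 / 2" for a b :: real
  proof -
    have "exp a = (exp (a / 2))\<^sup>2" "exp b = (exp (b / 2))\<^sup>2" "exp ((a + b) / 2) = exp (a / 2) * exp (b / 2)"
      by (simp_all add: exp_double[symmetric] exp_add[symmetric] add_divide_distrib)
    then show ?thesis by (simp add: power2_diff field_simps)
  qed
  have pw: "sum_along w \<phi> = (sum_along y \<phi> + sum_along z \<phi>) / 2" for \<phi> :: "'d \<Rightarrow> 'n"
    by (simp add: w_def sum_along_add sum_along_scaleR)
  have "potential F w < (\<Sum>\<phi>\<in>UNIV. weight F \<phi> * ((exp (sum_along y \<phi>) + exp (sum_along z \<phi>)) / 2))"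
    unfolding potential_def
  proof (rule sum_strict_mono_ex1)
    show "\<forall>\<phi>\<in>UNIV. weight F \<phi> * exp (sum_along w \<phi>) \<le> weight F \<phi> * ((exp (sum_along y \<phi>) + exp (sum_along z \<phi>)) / 2)"
    proof
      fix \<phi>
      show "weight F \<phi> * exp (sum_along w \<phi>) \<le> weight F \<phi> * ((exp (sum_along y \<phi>) + exp (sum_along z \<phi>)) / 2)"
        using split[of "sum_along y \<phi>" "sum_along z \<phi>"] zero_le_power2[of "exp (sum_along y \<phi> / 2) - exp (sum_along z \<phi> / 2)"]
        unfolding pw by (intro mult_left_mono weight_nonneg) linarith
    qed
    have "exp (sum_along y \<psi> / 2) - exp (sum_along z \<psi> / 2) \<noteq> 0" using \<psi>' by simp
    then have "exp (sum_along w \<psi>) < (exp (sum_along y \<psi>) + exp (sum_along z \<psi>)) / 2"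
      using split[of "sum_along y \<psi>" "sum_along z \<psi>"] zero_less_power2[of "exp (sum_along y \<psi> / 2) - exp (sum_along z \<psi> / 2)"]
      unfolding pw by linarith
    then show "\<exists>\<phi>\<in>UNIV. weight F \<phi> * exp (sum_along w \<phi>) < weight F \<phi> * ((exp (sum_along y \<phi>) + exp (sum_along z \<phi>)) / 2)"
      using \<psi>' by (intro bexI[of _ \<psi>]) auto
  qed simp
  also have "\<dots> = (potential F y + potential F z) / 2"
    by (simp add: potential_def sum.distrib distrib_left add_divide_distrib sum_divide_distrib)
  also have "\<dots> = potential F y"
    using y z by (simp add: is_minimizer_def) (meson order_antisym)
  finally show False using y w by (force simp: is_minimizer_def)
qed

lemma minimizer_critical:
  fixes F :: "complex^'n^'d"
  assumes y: "is_minimizer F y" and h: "h \<in> zero_sum"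
  shows "(\<Sum>\<phi>\<in>UNIV. sum_along h \<phi> * (exp (sum_along y \<phi>) * weight F \<phi>)) = 0"
proof -
  define g where "g t = (\<Sum>\<phi>\<in>UNIV. weight F \<phi> * exp (sum_along y \<phi> + t * sum_along h \<phi>))" for t
  have g: "g t = potential F (y + t *\<^sub>R h)" for t
    by (simp add: g_def potential_def sum_along_add sum_along_scaleR)
  have "(g has_real_derivative (\<Sum>\<phi>\<in>UNIV. weight F \<phi> * (exp (sum_along y \<phi>) * sum_along h \<phi>))) (at 0)"
    unfolding g_def by (auto intro!: derivative_eq_intros sum.cong)
  moreover have "g 0 \<le> g t" for t
    using y h unfolding g is_minimizer_def by (auto intro: zero_sum_add zero_sum_scaleR)
  ultimately have "(\<Sum>\<phi>\<in>UNIV. weight F \<phi> * (exp (sum_along y \<phi>) * sum_along h \<phi>)) = 0"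
    using DERIV_local_min[of g _ 0 1] by auto
  then show ?thesis by (simp only: mult_ac)
qed

definition minimizer :: "complex^'n^'d \<Rightarrow> real^'n" where
  "minimizer F = (SOME y. is_minimizer F y)"

lemma is_minimizer_minimizer: "F \<in> stable \<Longrightarrow> is_minimizer F (minimizer F)"
  unfolding minimizer_def by (rule someI_ex[OF minimizer_exists])

text \<open>
  If minimizers \<open>Y k\<close> of \<open>X k\<close> stayed at distance \<open>e\<close> from \<open>y\<close>, convexity would give points at
  distance exactly \<open>e\<close> from \<open>y\<close> whose potential does not exceed that of \<open>y\<close>. A limit of these
  points would be a second minimizer of the limit potential.
\<close>

lemma continuous_on_minimizer:
  "continuous_on stable (minimizer :: complex^'n^'d \<Rightarrow> real^'n)"
  unfolding continuous_on_sequentially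
proof (intro allI ballI impI, elim conjE)
  fix X and F :: "complex^'n^'d"
  assume F: "F \<in> stable" and X: "\<forall>k. X k \<in> stable" and lim: "X \<longlonglongrightarrow> F"
  define y where "y = minimizer F"
  define Y where "Y k = minimizer (X k)" for k
  have y: "is_minimizer F y" using F by (simp add: y_def is_minimizer_minimizer)
  have Y: "is_minimizer (X k) (Y k)" for k using X by (simp add: Y_def is_minimizer_minimizer)
  have "Y \<longlonglongrightarrow> y"
  proof (rule ccontr)
    assume "\<not> Y \<longlonglongrightarrow> y"
    then obtain e where e: "e > 0" and "\<exists>\<^sub>F k in sequentially. \<not> dist (Y k) y < e"
      unfolding tendsto_iff not_eventually[symmetric] by blast
    then have "infinite {k. \<not> dist (Y k) y < e}"
      by (simp add: cofinite_eq_sequentially[symmetric] frequently_cofinite)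
    then obtain r :: "nat \<Rightarrow> nat" where r: "strict_mono r" "\<And>k. \<not> dist (Y (r k)) y < e"
      using infinite_enumerate by blast
    \<comment> \<open>\<open>Z k\<close> is the point of the segment from \<open>y\<close> to \<open>Y (r k)\<close> at distance \<open>e\<close> from \<open>y\<close>.\<close>
    define t where "t k = e / dist (Y (r k)) y" for k
    define Z where "Z k = (1 - t k) *\<^sub>R y + t k *\<^sub>R Y (r k)" for k
    have t: "0 \<le> t k" "t k \<le> 1" for k
      using e r(2)[of k] by (simp_all add: t_def divide_le_eq_1)
    have Zle: "potential (X (r k)) (Z k) \<le> potential (X (r k)) y" for k
    proof -
      have "potential (X (r k)) (Z k) \<le> (1 - t k) * potential (X (r k)) y + t k * potential (X (r k)) (Y (r k))"
        unfolding Z_def by (rule potential_convex[OF t])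
      also have "\<dots> \<le> (1 - t k) * potential (X (r k)) y + t k * potential (X (r k)) y"
        using Y[of "r k"] y t(1)[of k] by (intro add_left_mono mult_left_mono) (auto simp: is_minimizer_def)
      finally show ?thesis by (simp add: algebra_simps)
    qed
    let ?K = "zero_sum \<inter> sphere y e"
    have "compact ?K" by (intro closed_Int_compact closed_zero_sum) simp
    moreover have "Z k \<in> ?K" for k
    proof -
      have "Z k \<in> zero_sum"
        using y Y[of "r k"] by (auto simp: Z_def is_minimizer_def intro: zero_sum_add zero_sum_scaleR)
      moreover have "Z k - y = t k *\<^sub>R (Y (r k) - y)"
        by (simp add: Z_def algebra_simps)
      then have "dist (Z k) y = t k * dist (Y (r k)) y"
        using t(1)[of k] by (simp add: dist_norm)
      then have "dist y (Z k) = e"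
        using e r(2)[of k] by (auto simp: t_def dist_commute)
      ultimately show ?thesis by simp
    qed
    ultimately obtain l q where l: "l \<in> ?K" and q: "strict_mono (q::nat\<Rightarrow>nat)" and Zl: "(Z \<circ> q) \<longlonglongrightarrow> l"
      unfolding compact_def by metis
    have Xr: "(\<lambda>k. X (r (q k))) \<longlonglongrightarrow> F"
      using LIMSEQ_subseq_LIMSEQ[OF lim strict_mono_o[OF r(1) q]] by (simp add: o_def)
    have "(\<lambda>k. potential (X (r (q k))) (Z (q k))) \<longlonglongrightarrow> potential F l"
      using Zl by (intro tendsto_potential Xr) (simp add: o_def)
    moreover have "(\<lambda>k. potential (X (r (q k))) y) \<longlonglongrightarrow> potential F y"
      by (intro tendsto_potential Xr tendsto_const)
    ultimately have "potential F l \<le> potential F y"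
      by (rule LIMSEQ_le) (auto simp: Zle)
    then have "is_minimizer F l"
      using y l unfolding is_minimizer_def by (auto intro: order_trans)
    then have "l = y" using minimizer_unique[OF F] y by blast
    then show False using l e by simp
  qed
  then show "(minimizer \<circ> X) \<longlonglongrightarrow> minimizer F"
    unfolding Y_def y_def o_def .
qed

text \<open>
  The inequality \<open>1 + x \<le> exp x\<close> shows directly that the critical point \<open>0\<close> is a minimizer.
\<close>

lemma minimizer_eq_0_if_FUNTF:
  fixes F :: "complex^'n^'d"
  assumes F: "F \<in> stable" "F \<in> FUNTF"
  shows "minimizer F = 0"
proof -
  have "potential F 0 \<le> potential F z" if z: "z \<in> zero_sum" for z
  proof -
    have "potential F 0 = (\<Sum>\<phi>\<in>UNIV. weight F \<phi> + sum_along z \<phi> * weight F \<phi>)"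
      using FUNTF_critical[OF F(2) z] by (simp add: potential_def sum.distrib)
    also have "\<dots> = (\<Sum>\<phi>\<in>UNIV. weight F \<phi> * (1 + sum_along z \<phi>))"
      by (simp add: algebra_simps)
    also have "\<dots> \<le> potential F z"
      unfolding potential_def by (intro sum_mono mult_left_mono exp_ge_add_one_self) auto
    finally show ?thesis .
  qed
  then have "is_minimizer F 0" by (simp add: is_minimizer_def)
  then show ?thesis using minimizer_unique[OF F(1) is_minimizer_minimizer[OF F(1)]] by blast
qed

section \<open>The correlation graph\<close>

definition adjacency :: "complex^'n^'d \<Rightarrow> ('n \<times> 'n) set" where
  "adjacency F = {(m, n). herm (column m F) (column n F) \<noteq> 0}"

lemma sym_adjacency: "sym (adjacency F)"
proof (rule symI)
  fix m n assume "(m, n) \<in> adjacency F"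
  then show "(n, m) \<in> adjacency F"
    using herm_cnj[of "column m F" "column n F"] by (auto simp: adjacency_def)
qed

text \<open>
  Suppose that \<open>h\<close> violates stability. The weighted sum of the numbers \<open>sum_along h \<phi>\<close> vanishes for a
  FUNTF, so they are zero, and not just nonpositive, for all nonzero minors. So
  scaling the columns by \<open>exp (h\<^sub>n / 2)\<close> does not change the weights, and the orthonormalized scaled matrix
  \<open>P\<close> has the same column norms as \<open>Q\<close>. For an index \<open>n\<close> at which \<open>h\<close> is maximal, Cauchy-Schwarz applied
  to the \<open>n\<close>-th column of \<open>P\<close> yields \<open>exp (h\<^sub>n) \<Sum>\<^sub>m c\<^sub>m \<le> \<Sum>\<^sub>m exp (h\<^sub>m) c\<^sub>m\<close> with \<open>c\<^sub>m\<close> the squared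
  correlations of the columns \<open>m\<close> and \<open>n\<close>. Hence \<open>h\<close> is maximal at every neighbour of \<open>n\<close> as well, and
  by connectedness \<open>h\<close> is constant, that is \<open>0\<close>.
\<close>

lemma connected_FUNTF_stable:
  fixes F :: "complex^'n^'d"
  assumes F: "F \<in> FUNTF" and conn: "(adjacency F)\<^sup>* = UNIV"
  shows "F \<in> stable"
proof (rule ccontr)
  assume "F \<notin> stable"
  then obtain h where h: "h \<in> zero_sum" "h \<noteq> 0" and np: "\<And>\<phi>. minor F \<phi> \<noteq> 0 \<Longrightarrow> sum_along h \<phi> \<le> 0"
    unfolding stable_def by force
  from F obtain s Q where s: "s > 0" and s2: "s\<^sup>2 = real CARD('n) / real CARD('d)"
    and FQ: "F = s *\<^sub>R Q" and Q: "Q ** conj_transpose Q = mat 1"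
    and nQ: "\<And>n. (norm (column n Q))\<^sup>2 = real CARD('d) / real CARD('n)"
    by (rule FUNTF_rescale) (rule that)
  define r where "r = real CARD('d) / real CARD('n)"
  have r: "r > 0" by (simp add: r_def)
  have critQ: "(\<Sum>\<phi>\<in>UNIV. sum_along g \<phi> * weight Q \<phi>) = 0" if "g \<in> zero_sum" for g
    by (rule equal_column_norms_critical[OF Q nQ that])
  have "sum_along h \<phi> * weight Q \<phi> \<le> 0" for \<phi>
    using np[of \<phi>] s unfolding FQ minor_scaleR by (cases "minor Q \<phi> = 0") (auto simp: mult_nonpos_nonneg weight_def)
  then have "\<forall>\<phi>\<in>UNIV. - (sum_along h \<phi> * weight Q \<phi>) = 0"
    using critQ[OF h(1)] by (subst sum_nonneg_eq_0_iff[symmetric]) (auto simp: sum_negf)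
  then have flat: "exp (sum_along h \<phi>) * weight Q \<phi> = weight Q \<phi>" for \<phi> by auto
  define B where "B = colscale (\<lambda>n. exp (h $ n / 2)) Q"
  have minorB: "minor B \<phi> = of_real (exp (sum_along h \<phi> / 2)) * minor Q \<phi>" for \<phi>
    by (simp add: B_def minor_colscale sum_along_def exp_sum sum_divide_distrib)
  have "\<exists>\<phi>. minor Q \<phi> \<noteq> 0" by (rule orthonormal_rows_minor[OF Q])
  then have "\<exists>\<phi>. minor B \<phi> \<noteq> 0" by (simp add: minorB)
  then obtain L where L: "det L \<noteq> 0" "(L ** B) ** conj_transpose (L ** B) = mat 1"
    using row_orthonormalization[of "UNIV :: real set" "\<lambda>_. B"] by auto
  define P where "P = L ** B"
  have P: "P ** conj_transpose P = mat 1" unfolding P_def by (rule L)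
  have wP: "weight P \<phi> = (cmod (det L))\<^sup>2 * weight Q \<phi>" for \<phi>
  proof -
    have "weight P \<phi> = (cmod (det L))\<^sup>2 * ((exp (sum_along h \<phi> / 2))\<^sup>2 * weight Q \<phi>)"
      unfolding weight_def P_def minor_mult minorB norm_mult norm_of_real by (simp add: power_mult_distrib)
    then show ?thesis using flat[of \<phi>] by (simp add: exp_double[symmetric])
  qed
  have "(\<Sum>\<phi>\<in>UNIV. sum_along g \<phi> * weight P \<phi>) = 0" if "g \<in> zero_sum" for g
  proof -
    have "(\<Sum>\<phi>\<in>UNIV. sum_along g \<phi> * weight P \<phi>) = (cmod (det L))\<^sup>2 * (\<Sum>\<phi>\<in>UNIV. sum_along g \<phi> * weight Q \<phi>)"
      unfolding wP sum_distrib_left by (simp only: mult_ac)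
    then show ?thesis using critQ[OF that] by simp
  qed
  from equal_column_norms[OF P this] have nP: "(norm (column n P))\<^sup>2 = r" for n
    unfolding r_def by blast
  obtain J where J: "J ** L = mat 1"
    using L(1) invertible_det_nz[of L] unfolding invertible_def by blast
  have BP: "B = J ** P" by (simp add: P_def matrix_mul_assoc J)
  define top where "top = Max (range (($) h))"
  have top: "h $ m \<le> top" for m unfolding top_def by (rule Max_ge) auto
  obtain n0 where n0: "h $ n0 = top"
  proof -
    have "top \<in> range (($) h)" unfolding top_def by (rule Max_in) auto
    then show thesis using that by auto
  qed
  have step: "h $ m = top" if n: "h $ n = top" and adj: "(m, n) \<in> adjacency F" for m n
  proof -
    let ?c = "\<lambda>m. (cmod (herm (column m Q) (column n Q)))\<^sup>2"
    \<comment> \<open>The entries of \<open>z v* B\<close> are the scaled correlations with the column \<open>n\<close>, and \<open>z v* B\<close> lies in the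
      row space of \<open>P\<close>. A vector in the row space is bounded, at the coordinate \<open>n\<close>, by its norm times the
      norm of the column \<open>n\<close> of \<open>P\<close>.\<close>
    define z where "z = (\<chi> i. cnj (Q $ i $ n))"
    have zB: "(z v* B) $ m = of_real (exp (h $ m / 2)) * herm (column m Q) (column n Q)" for m
      by (simp add: z_def vector_matrix_mult_def B_def colscale_def herm_def column_def sum_distrib_left mult_ac)
    have "z v* B = (z v* J) v* P" unfolding BP by (simp add: vector_matrix_mul_assoc)
    define t where "t = z v* J"
    have t: "z v* B = t v* P" unfolding t_def by fact
    have "cmod ((z v* B) $ n) = cmod (herm t (\<chi> i. cnj (column n P $ i)))"
      unfolding t by (simp add: vector_matrix_mult_def herm_def column_def mult.commute)
    also have "\<dots> \<le> norm t * norm (\<chi> i. cnj (column n P $ i))" by (rule herm_cauchy_schwarz)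
    also have "norm (\<chi> i. cnj (column n P $ i)) = norm (column n P)" by (simp add: norm_vec_def)
    also have "norm t = norm (z v* B)" unfolding t orthonormal_rows_isometry[OF P] ..
    finally have "(cmod ((z v* B) $ n))\<^sup>2 \<le> (norm (z v* B))\<^sup>2 * r"
      unfolding nP[of n, symmetric] power_mult_distrib[symmetric] by (rule power_mono) simp
    also have "(norm (z v* B))\<^sup>2 = (\<Sum>m\<in>UNIV. exp (h $ m) * ?c m)"
      by (simp add: norm_vec_def L2_set_def sum_nonneg zB norm_mult power_mult_distrib exp_double[symmetric])
    also have "(cmod ((z v* B) $ n))\<^sup>2 = exp top * r * r"
      by (simp add: zB herm_self norm_mult power_mult_distrib exp_double[symmetric] n nQ[folded r_def] norm_power)
        (simp add: power2_eq_square)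
    finally have "exp top * r \<le> (\<Sum>m\<in>UNIV. exp (h $ m) * ?c m)"
      using r by simp
    also have "r = (\<Sum>m\<in>UNIV. ?c m)"
      unfolding sum_squared_correlations[OF Q] nQ r_def ..
    finally have "(\<Sum>m\<in>UNIV. (exp top - exp (h $ m)) * ?c m) \<le> 0"
      by (simp add: sum_distrib_left left_diff_distrib sum_subtractf)
    moreover have nn: "(exp top - exp (h $ m)) * ?c m \<ge> 0" for m using top[of m] by simp
    ultimately have "(\<Sum>m\<in>UNIV. (exp top - exp (h $ m)) * ?c m) = 0"
      by (meson order_antisym sum_nonneg)
    then have "(exp top - exp (h $ m)) * ?c m = 0"
      using nn by (subst (asm) sum_nonneg_eq_0_iff) auto
    moreover have "column k F = of_real s *s column k Q" for k
      by (simp add: FQ column_def vec_eq_iff scaleR_conv_of_real[symmetric])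
    then have "herm (column m Q) (column n Q) \<noteq> 0"
      using adj by (auto simp: adjacency_def herm_smult_left herm_smult_right)
    ultimately show ?thesis by simp
  qed
  have "h $ m = top" for m
  proof -
    have "(m, n0) \<in> (adjacency F)\<^sup>*" using conn by simp
    then show ?thesis by (induction rule: converse_rtrancl_induct) (auto simp: n0 step)
  qed
  then have "h = (\<chi> _. top)" by (simp add: vec_eq_iff)
  then have "h = 0" using h(1) by (simp add: zero_sum_def vec_eq_iff)
  then show False using h(2) by simp
qed

text \<open>
  The columns \<open>a\<close> and \<open>b\<close> are orthogonal, so rotating them into one another keeps them unit vectors, and any
  rotation keeps the sum of their contributions to the frame operator. After the rotation both
  columns are correlated with every other former neighbour of either: such a neighbour is orthogonal to one
  of the two old columns, so nothing cancels. Since \<open>N > d\<close>, the column \<open>a\<close> does have a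
  neighbour \<open>m\<close>, and the new columns \<open>a\<close> and \<open>b\<close> are connected through it.
\<close>

lemma merge_components:
  fixes F :: "complex^'n^'d"
  assumes F: "F \<in> FUNTF" and card: "CARD('d) < CARD('n)" and ab: "(a, b) \<notin> (adjacency F)\<^sup>*"
  shows "\<exists>G\<in>FUNTF. path_component FUNTF F G \<and> (adjacency F)\<^sup>* \<subset> (adjacency G)\<^sup>*"
proof -
  have unit: "herm (column n F) (column n F) = 1" for n
    using F unfolding FUNTF_def norm_eq_1_iff_herm by simp
  have nadj: "(p, q) \<notin> adjacency F" if "(a, p) \<in> (adjacency F)\<^sup>*" "(b, q) \<in> (adjacency F)\<^sup>*" for p q
  proof
    assume "(p, q) \<in> adjacency F"
    moreover have "(q, b) \<in> (adjacency F)\<^sup>*"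
      using that(2) sym_rtrancl[OF sym_adjacency] by (metis symD)
    ultimately show False using that(1) ab by (meson converse_rtrancl_into_rtrancl rtrancl_trans)
  qed
  have neq: "a \<noteq> b" using ab by auto
  have hab: "herm (column a F) (column b F) = 0" "herm (column b F) (column a F) = 0"
    using nadj[of a b] sym_adjacency[of F] by (auto simp: adjacency_def sym_def)
  define rot where "rot t = (\<chi> i n. if n = a then of_real (cos t) * F $ i $ a + of_real (sin t) * F $ i $ b
     else if n = b then of_real (cos t) * F $ i $ b - of_real (sin t) * F $ i $ a else F $ i $ n)" for t
  have col_a: "column a (rot t) = of_real (cos t) *s column a F + of_real (sin t) *s column b F" for t
    by (simp add: vec_eq_iff column_def rot_def)
  have col_b: "column b (rot t) = of_real (cos t) *s column b F - of_real (sin t) *s column a F" for t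
    using neq by (simp add: vec_eq_iff column_def rot_def)
  have col: "column n (rot t) = column n F" if "n \<noteq> a" "n \<noteq> b" for n t
    using that by (simp add: vec_eq_iff column_def rot_def)
  have cs: "of_real (cos t) * of_real (cos t) + of_real (sin t) * of_real (sin t) = (1::complex)" for t
    unfolding of_real_mult[symmetric] of_real_add[symmetric] by (simp flip: power2_eq_square)
  have rot_unit: "norm (column n (rot t)) = 1" for n t
  proof -
    consider "n = a" | "n = b" | "n \<noteq> a" "n \<noteq> b" by blast
    then show ?thesis
    proof cases
      case 1
      show ?thesis unfolding 1 norm_eq_1_iff_herm col_a
        by (simp add: herm_add_left herm_add_right herm_smult_left herm_smult_right hab unit cs)
    next
      case 2
      show ?thesis unfolding 2 norm_eq_1_iff_herm col_b
        by (simp add: herm_diff_left herm_diff_right herm_smult_left herm_smult_right hab unit cs)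
    next
      case 3
      then show ?thesis unfolding norm_eq_1_iff_herm by (simp add: col unit)
    qed
  qed
  have split: "(\<Sum>n\<in>UNIV. f n) = (f a + f b) + (\<Sum>n\<in>UNIV - {a} - {b}. f n)" for f :: "'n \<Rightarrow> complex"
    using sum.remove[of UNIV a f] sum.remove[of "UNIV - {a}" b f] neq by simp
  have rot_tight: "herm (rot t $ i) (rot t $ j) = herm (F $ i) (F $ j)" for t i j
  proof -
    let ?c = "complex_of_real (cos t)" and ?s = "complex_of_real (sin t)"
    have "rot t $ i $ a * cnj (rot t $ j $ a) + rot t $ i $ b * cnj (rot t $ j $ b)
        = (?c * ?c + ?s * ?s) * (F $ i $ a * cnj (F $ j $ a) + F $ i $ b * cnj (F $ j $ b))"
      using neq by (simp add: rot_def algebra_simps)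
    moreover have "(\<Sum>n\<in>UNIV - {a} - {b}. rot t $ i $ n * cnj (rot t $ j $ n))
        = (\<Sum>n\<in>UNIV - {a} - {b}. F $ i $ n * cnj (F $ j $ n))"
      by (rule sum.cong) (auto simp: rot_def)
    ultimately show ?thesis unfolding herm_def split cs by simp
  qed
  have rot_FUNTF: "rot t \<in> FUNTF" for t
  proof -
    have "rot t ** conj_transpose (rot t) = F ** conj_transpose F"
      by (simp add: vec_eq_iff frame_operator_entry rot_tight)
    then show ?thesis using F rot_unit unfolding FUNTF_def by simp
  qed
  have "continuous_on UNIV (\<lambda>t. rot t $ i $ n)" for i n
    unfolding rot_def by (cases "n = a"; cases "n = b") (auto intro!: continuous_intros)
  then have "continuous_on UNIV (\<lambda>t. \<chi> i n. rot t $ i $ n)" by (intro continuous_on_vec_lambda)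
  then have "path_connected (range rot)"
    by (intro path_connected_continuous_image) simp_all
  then have "path_component (range rot) (rot 0) (rot (pi / 4))"
    by (simp add: path_connected_component)
  moreover have "rot 0 = F" by (simp add: rot_def vec_eq_iff)
  moreover define G where "G = rot (pi / 4)"
  ultimately have path: "path_component FUNTF F G"
    using path_component_of_subset[of "range rot" FUNTF] rot_FUNTF by auto
  \<comment> \<open>At the angle \<open>pi / 4\<close> both coefficients are nonzero, so correlations are inherited by both columns.\<close>
  define c where "c = complex_of_real (cos (pi / 4))"
  define s where "s = complex_of_real (sin (pi / 4))"
  have cs0: "c \<noteq> 0" "s \<noteq> 0" by (simp_all add: c_def s_def cos_45 sin_45)
  have Ga: "herm (column a G) (column q G) = c * herm (column a F) (column q F) + s * herm (column b F) (column q F)"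
    and Gb: "herm (column b G) (column q G) = c * herm (column b F) (column q F) - s * herm (column a F) (column q F)"
    if "q \<noteq> a" "q \<noteq> b" for q
    using that by (simp_all add: G_def col_a col_b col herm_add_left herm_diff_left herm_smult_left c_def s_def)
  have mix_a: "(a, q) \<in> adjacency G \<and> (b, q) \<in> adjacency G" if "(a, q) \<in> adjacency F" "q \<noteq> a" for q
  proof -
    have "(q, b) \<notin> adjacency F" "q \<noteq> b"
      using nadj[of q b] nadj[of a q] that by auto
    then have "herm (column b F) (column q F) = 0"
      using sym_adjacency[of F] by (auto simp: adjacency_def sym_def)
    then show ?thesis using that \<open>q \<noteq> b\<close> cs0 by (simp add: adjacency_def Ga Gb)
  qed
  have mix_b: "(a, q) \<in> adjacency G \<and> (b, q) \<in> adjacency G" if "(b, q) \<in> adjacency F" "q \<noteq> b" for q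
  proof -
    have "(a, q) \<notin> adjacency F" "q \<noteq> a"
      using nadj[of a q] nadj[of a b] that sym_adjacency[of F] by (auto simp: sym_def)
    then show ?thesis using that cs0 by (simp add: adjacency_def Ga Gb)
  qed
  have refl: "(q, q) \<in> adjacency G" for q
    using rot_unit[of q "pi / 4"] unfolding norm_eq_1_iff_herm by (simp add: adjacency_def G_def)
  have adj: "(p, q) \<in> adjacency G" if pq: "(p, q) \<in> adjacency F" for p q
  proof -
    have qp: "(q, p) \<in> adjacency F" using pq sym_adjacency by (metis symD)
    consider "p = q" | "p = a" "q \<noteq> a" | "p = b" "q \<noteq> b" | "q = a" "p \<noteq> a" | "q = b" "p \<noteq> b"
      | "p \<notin> {a, b}" "q \<notin> {a, b}" by blast
    then show ?thesis
    proof cases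
      case 1
      then show ?thesis by (simp add: refl)
    next
      case 2
      then show ?thesis using mix_a pq by blast
    next
      case 3
      then show ?thesis using mix_b pq by blast
    next
      case 4
      then show ?thesis using mix_a qp sym_adjacency by (metis symD)
    next
      case 5
      then show ?thesis using mix_b qp sym_adjacency by (metis symD)
    next
      case 6
      then show ?thesis using pq by (simp add: adjacency_def G_def col)
    qed
  qed
  have "\<exists>m. m \<noteq> a \<and> (a, m) \<in> adjacency F"
  proof (rule ccontr)
    assume "\<nexists>m. m \<noteq> a \<and> (a, m) \<in> adjacency F"
    then have "(cmod (herm (column m F) (column a F)))\<^sup>2 = (if m = a then 1 else 0)" for m
      using unit sym_adjacency[of F] by (auto simp: adjacency_def sym_def)
    then have "real CARD('n) / real CARD('d) = 1"
      using FUNTF_sum_squared_correlations[OF F, of a] by simp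
    then show False using card by simp
  qed
  then obtain m where m: "m \<noteq> a" "(a, m) \<in> adjacency F" by blast
  have "(a, m) \<in> adjacency G" "(m, b) \<in> adjacency G"
    using mix_a[OF m(2,1)] sym_adjacency by (auto dest: symD)
  then have "(a, b) \<in> (adjacency G)\<^sup>*" by (meson r_into_rtrancl rtrancl_trans)
  moreover have "(adjacency F)\<^sup>* \<subseteq> (adjacency G)\<^sup>*" by (intro rtrancl_mono) (auto simp: adj)
  ultimately have "(adjacency F)\<^sup>* \<subset> (adjacency G)\<^sup>*" using ab by blast
  then show ?thesis using path rot_FUNTF unfolding G_def by blast
qed

lemma path_to_connected_FUNTF:
  fixes F :: "complex^'n^'d"
  assumes "F \<in> FUNTF" and card: "CARD('d) < CARD('n)"
  shows "\<exists>G\<in>FUNTF. path_component FUNTF F G \<and> (adjacency G)\<^sup>* = UNIV"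
  using assms(1)
proof (induction "card (- (adjacency F)\<^sup>*)" arbitrary: F rule: less_induct)
  case less
  show ?case
  proof (cases "(adjacency F)\<^sup>* = UNIV")
    case True
    then show ?thesis using less.prems path_component_refl by blast
  next
    case False
    then obtain a b where "(a, b) \<notin> (adjacency F)\<^sup>*" by auto
    from merge_components[OF less.prems card this] obtain G where G: "G \<in> FUNTF"
      "path_component FUNTF F G" "(adjacency F)\<^sup>* \<subset> (adjacency G)\<^sup>*" by blast
    have "card (- (adjacency G)\<^sup>*) < card (- (adjacency F)\<^sup>*)"
      by (rule psubset_card_mono) (use G(3) in auto)
    from less.hyps[OF this G(1)] show ?thesis using G(2) path_component_trans by blast
  qed
qed

section \<open>Path-connectedness\<close>

lemma stable_FUNTF_joined:
  fixes F G :: "complex^'n^'d"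
  assumes FG: "F \<in> stable" "G \<in> stable" "F \<in> FUNTF" "G \<in> FUNTF" and card: "CARD('d) < CARD('n)"
  shows "path_component FUNTF F G"
proof (rule FUNTF_path_by_retraction[OF _ _ continuous_on_minimizer _ _ FG])
  show "path_connected (stable :: (complex^'n^'d) set)"
    by (rule path_connected_minor_support) (unfold stable_def, blast)
  show "\<exists>\<phi>. minor F \<phi> \<noteq> 0" if "F \<in> stable" for F :: "complex^'n^'d"
  proof -
    \<comment> \<open>The hyperplane contains a nonzero vector, because there are at least two columns.\<close>
    have "1 < CARD('n)" using card zero_less_card_finite[where 'a='d] by linarith
    then obtain m n :: 'n where "m \<noteq> n"
      by (metis card_1_singleton_iff card_le_Suc0_iff_eq finite_class.finite_UNIV iso_tuple_UNIV_I not_less One_nat_def)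
    then have "axis m 1 - axis n 1 \<noteq> (0 :: real^'n)" by (simp add: axis_eq_axis)
    moreover have "axis m 1 - axis n 1 \<in> (zero_sum :: (real^'n) set)"
      by (simp add: zero_sum_def sum_subtractf axis_def)
    ultimately show ?thesis using that unfolding stable_def by blast
  qed
  show "(\<Sum>\<phi>\<in>UNIV. sum_along h \<phi> * (exp (sum_along (minimizer F) \<phi>) * weight F \<phi>)) = 0"
    if "F \<in> stable" "h \<in> zero_sum" for F :: "complex^'n^'d" and h
    using minimizer_critical[OF is_minimizer_minimizer] that by blast
  show "minimizer F = 0" if "F \<in> stable" "F \<in> FUNTF" for F :: "complex^'n^'d"
    using minimizer_eq_0_if_FUNTF that by blast
qed

text \<open>
  A nonzero minor now uses every column exactly once, so \<open>sum_along h \<phi>\<close> is the full sum of \<open>h\<close>. It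
  vanishes, and the scaling exponents \<open>y = 0\<close> are always critical.
\<close>

lemma square_FUNTF_joined:
  fixes F G :: "complex^'n^'d"
  assumes FG: "F \<in> FUNTF" "G \<in> FUNTF" and card: "CARD('n) = CARD('d)"
  shows "path_component FUNTF F G"
proof -
  let ?\<Omega> = "{F :: complex^'n^'d. \<exists>\<phi>. minor F \<phi> \<noteq> 0}"
  have sub: "F \<in> ?\<Omega>" if "F \<in> FUNTF" for F
    using FUNTF_has_minor[OF that] by simp
  show ?thesis
  proof (rule FUNTF_path_by_retraction[where \<Omega> = ?\<Omega> and y = "\<lambda>_. 0"])
    show "path_connected ?\<Omega>" by (rule path_connected_minor_support) blast
    show "(\<Sum>\<phi>\<in>UNIV. sum_along h \<phi> * (exp (sum_along 0 \<phi>) * weight F \<phi>)) = 0"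
      if h: "h \<in> zero_sum" for F :: "complex^'n^'d" and h
    proof (intro sum.neutral ballI)
      fix \<phi> :: "'d \<Rightarrow> 'n"
      show "sum_along h \<phi> * (exp (sum_along 0 \<phi>) * weight F \<phi>) = 0"
      proof (cases "inj \<phi>")
        case True
        then have "card (range \<phi>) = CARD('n)" using card by (simp add: card_image)
        then have "bij \<phi>" using True by (simp add: bij_betw_def card_eq_UNIV_imp_eq_UNIV)
        then have "sum_along h \<phi> = 0"
          using h sum.reindex_bij_betw[of \<phi> UNIV UNIV "($) h"] by (simp add: sum_along_def zero_sum_def)
        then show ?thesis by simp
      next
        case False
        then obtain i j where "i \<noteq> j" "\<phi> i = \<phi> j" by (auto simp: inj_def)
        then have "minor F \<phi> = 0"
          unfolding minor_def by (intro det_identical_rows[of i j]) (auto simp: row_def)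
        then show ?thesis by simp
      qed
    qed
  qed (use FG sub in auto)
qed

theorem theorem1p1:
  assumes "CARD('n::finite) \<ge> CARD('d::finite)"
  shows "path_connected (FUNTF :: (complex^'n^'d) set)"
  unfolding path_connected_component
proof (intro ballI)
  fix F G :: "complex^'n^'d"
  assume FG: "F \<in> FUNTF" "G \<in> FUNTF"
  show "path_component FUNTF F G"
  proof (cases "CARD('n) = CARD('d)")
    case True
    then show ?thesis using square_FUNTF_joined FG by blast
  next
    case False
    then have card: "CARD('d) < CARD('n)" using assms by simp
    obtain F' G' where "F' \<in> FUNTF" "path_component FUNTF F F'" "(adjacency F')\<^sup>* = UNIV"
      "G' \<in> FUNTF" "path_component FUNTF G G'" "(adjacency G')\<^sup>* = UNIV"
      using path_to_connected_FUNTF[OF _ card] FG by metis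
    moreover from this have "path_component FUNTF F' G'"
      using stable_FUNTF_joined connected_FUNTF_stable card by blast
    ultimately show ?thesis by (meson path_component_sym path_component_trans)
  qed
qed

end
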